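(* Assume: (i) there exist $\mathfrak q,\mathfrak Q>0$ such that for any $\upsilon_1,\upsilon_2\in[-\mathfrak q,\mathfrak q]$, $\int_{\mathbb{R}}p(y+\upsilon_1)p(y+\upsilon_2)p^{-1}(y)\,dy\le1+\mathfrak Q|\upsilon_1\upsilon_2|$, where $p$ is the density of the noise $\varepsilon_1$; (ii) there exist $\mathfrak g>0$ and $\varpi>1$ such that $g(x)\le(1+|x|_2^{\varpi})^{-1}\mathfrak g$ for all $x\in\mathbb{R}^d$, where $g$ is the design density and $|\cdot|_2$ the Euclidean norm. Then for any $d\ge2$, $t\in[-1/2,1/2]^d$, $r\ge1$, $\beta>0$, there is a constant $\varkappa_2>0$ (independent of $n$ and $L$) such that for any $L>0$ and any $n\in\mathbb{N}^*$ large enough $$\inf_{\widetilde F}\sup_{F\in\mathbb{F}_d(\beta,L)}\mathcal R^{(n)}_{r,t}(\widetilde F,F)\ge\varkappa_2\,\psi_n(\beta,L),\qquad\psi_n(\beta,L)=L^{1/(2\beta+1)}\big[n^{-1}\ln(n)\big]^{\beta/(2\beta+1)},$$ where the infimum is over all possible estimators.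
   Context: **Model.** One observes $(X_1,Y_1),\dots,(X_n,Y_n)\in\mathbb{R}^d\times\mathbb{R}$, $Y_i=F(X_i)+\varepsilon_i$. The $X_i$ are i.i.d. with density $g$ with respect to Lebesgue measure on $\mathbb{R}^d$; the noise variables $\varepsilon_i$ are i.i.d. centered, with a symmetric distribution having Lebesgue density $p$ satisfying $\int_x^\infty p(y)\,dy\le\Upsilon e^{-\Omega x^\omega}$ for all $x\ge0$, with fixed $\Upsilon>0$, $\Omega\in(0,1]$, $\omega>0$; the sequences $(X_i)$ and $(\varepsilon_i)$ are independent. $\mathbb{E}^{(n)}_F$ is expectation under the law of $\{(X_i,Y_i)\}_{i=1}^n$. An estimator is a measurable function of $\{(X_i,Y_i)\}_{i=1}^n$, and $\mathcal R^{(n)}_{r,t}(\widetilde F,F)=\big(\mathbb{E}^{(n)}_F|\widetilde F(t)-F(t)|^r\big)^{1/r}$. **Classes.** $m_\beta$ is the maximal integer strictly less than $\beta$. $\mathbb{H}(\beta,L)$ is the set of $m_\beta$-times continuously differentiable $\ell:\mathbb{R}\to\mathbb{R}$ with $\|\ell^{(m)}\|_\infty\le L$ for all $m\le m_\beta$ and $|\ell^{(m_\beta)}(u+h)-\ell^{(m_\beta)}(u)|\le Lh^{\beta-m_\beta}$ for all $u\in\mathbb{R}$, $h>0$. $\mathbb{F}_d(\beta,L)=\{F:\mathbb{R}^d\to\mathbb{R}: F(z)=f(z^\top\theta),\ f\in\mathbb{H}(\beta,L),\ \theta\in\mathbb{S}^{d-1}\}$, with $\mathbb{S}^{d-1}$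 the unit sphere in $\mathbb{R}^d$. *)

theory Defs
  imports "HOL-Probability.Probability"
begin

definition smoothness_index :: "real \<Rightarrow> nat" where
  "smoothness_index \<beta> = (GREATEST m::nat. real m < \<beta>)"

definition holder_class :: "real \<Rightarrow> real \<Rightarrow> (real \<Rightarrow> real) set" where
  "holder_class \<beta> L = {f. let m = smoothness_index \<beta> in
     (\<forall>k<m. \<forall>u. (deriv ^^ k) f differentiable (at u)) \<and>
     continuous_on UNIV ((deriv ^^ m) f) \<and>
     (\<forall>k\<le>m. \<forall>u. \<bar>(deriv ^^ k) f u\<bar> \<le> L) \<and>
     (\<forall>u. \<forall>h>0. \<bar>(deriv ^^ m) f (u + h) - (deriv ^^ m) f u\<bar> \<le> L * h powr (\<beta> - real m))}"

definition single_index_class :: "real \<Rightarrow> real \<Rightarrow> (real^'d \<Rightarrow> real) set" where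
  "single_index_class \<beta> L =
     {F. \<exists>f\<in>holder_class \<beta> L. \<exists>\<theta>\<in>sphere 0 1. F = (\<lambda>z. f (z \<bullet> \<theta>))}"

definition prob_density :: "('a::euclidean_space \<Rightarrow> real) \<Rightarrow> bool" where
  "prob_density g \<longleftrightarrow>
     g \<in> borel_measurable borel \<and> (\<forall>x. 0 \<le> g x) \<and> prob_space (density lborel g)"

abbreviation sample_space :: "nat \<Rightarrow> (nat \<Rightarrow> (real^'d) \<times> real) measure" where
  "sample_space n \<equiv> PiM {1..n} (\<lambda>_. borel)"

text \<open>The law of the sample \<open>(X\<^sub>i, Y\<^sub>i)\<close>, \<open>i = 1, \<dots>, n\<close>: the designs \<open>x\<close> and the noise
  variables \<open>e\<close> are drawn from the product measure, which expresses that each sequence is i.i.d.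
  and that the two sequences are independent.\<close>

definition sample_law ::
    "(real^'d \<Rightarrow> real) \<Rightarrow> (real \<Rightarrow> real) \<Rightarrow> nat \<Rightarrow> (real^'d \<Rightarrow> real) \<Rightarrow> (nat \<Rightarrow> (real^'d) \<times> real) measure"
  where
  "sample_law g p n F =
     distr (PiM {1..n} (\<lambda>_. density lborel g) \<Otimes>\<^sub>M PiM {1..n} (\<lambda>_. density lborel p))
       (sample_space n)
       (\<lambda>(x, e). \<lambda>i\<in>{1..n}. (x i, F (x i) + e i))"

definition estimators :: "nat \<Rightarrow> ((nat \<Rightarrow> (real^'d) \<times> real) \<Rightarrow> real^'d \<Rightarrow> real) set" where
  "estimators n = {T. \<forall>x. (\<lambda>\<omega>. T \<omega> x) \<in> borel_measurable (sample_space n)}"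

definition ennreal_powr :: "ennreal \<Rightarrow> real \<Rightarrow> ennreal" where
  "ennreal_powr a s = (if a = \<top> then \<top> else ennreal (enn2real a powr s))"

text \<open>The risk takes values in \<open>[0, \<infinity>]\<close>, so that an estimator without a finite moment of
  order \<open>r\<close> has infinite risk.\<close>

definition risk ::
    "(real^'d \<Rightarrow> real) \<Rightarrow> (real \<Rightarrow> real) \<Rightarrow> nat \<Rightarrow> real \<Rightarrow> real^'d \<Rightarrow>
     ((nat \<Rightarrow> (real^'d) \<times> real) \<Rightarrow> real^'d \<Rightarrow> real) \<Rightarrow> (real^'d \<Rightarrow> real) \<Rightarrow> ennreal" where
  "risk g p n r t T F =
     ennreal_powr (\<integral>\<^sup>+ \<omega>. ennreal (\<bar>T \<omega> t - F t\<bar> powr r) \<partial>sample_law g p n F) (1 / r)"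

definition rate :: "nat \<Rightarrow> real \<Rightarrow> real \<Rightarrow> real" where
  "rate n \<beta> L =
     L powr (1 / (2 * \<beta> + 1)) * (inverse (real n) * ln (real n)) powr (\<beta> / (2 * \<beta> + 1))"

text \<open>Symmetry is a property of the noise distribution, not of the chosen version of its
  density.\<close>

definition noise_density :: "(real \<Rightarrow> real) \<Rightarrow> real \<Rightarrow> real \<Rightarrow> real \<Rightarrow> bool" where
  "noise_density p \<Upsilon> \<Omega> \<omega> \<longleftrightarrow>
     prob_density p \<and>
     has_bochner_integral (density lborel p) (\<lambda>y. y) 0 \<and>
     distr (density lborel p) borel uminus = density lborel p \<and>
     (\<forall>x\<ge>0. (LINT y:{x..}|lborel. p y) \<le> \<Upsilon> * exp (- \<Omega> * x powr \<omega>))"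

text \<open>The integrand is formed in the extended nonnegative reals, where \<open>a / 0 = \<infinity>\<close> for
  \<open>a > 0\<close> and \<open>0 / 0 = 0\<close>: the density \<open>p\<close> may not vanish where a small translate of it is
  positive. Division of real numbers would drop the zero set of \<open>p\<close> from the integral.\<close>

definition shift_condition :: "(real \<Rightarrow> real) \<Rightarrow> bool" where
  "shift_condition p \<longleftrightarrow>
     (\<exists>q>0. \<exists>Q>0. \<forall>v\<^sub>1\<in>{-q..q}. \<forall>v\<^sub>2\<in>{-q..q}.
        (\<integral>\<^sup>+ y. ennreal (p (y + v\<^sub>1)) * ennreal (p (y + v\<^sub>2)) / ennreal (p y) \<partial>lborel)
          \<le> ennreal (1 + Q * \<bar>v\<^sub>1 * v\<^sub>2\<bar>))"

definition design_condition :: "(real^'d \<Rightarrow> real) \<Rightarrow> bool" where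
  "design_condition g \<longleftrightarrow>
     (\<exists>G>0. \<exists>\<rho>>1. \<forall>x. g x \<le> inverse (1 + norm x powr \<rho>) * G)"

end

theory Submission
  imports Defs
begin

text \<open>
  Let \<open>\<phi>\<close> be a smooth bump supported on \<open>[-1, 1]\<close>. The ridge functions
  \<open>F\<^sub>u(x) = L h\<^sup>\<beta> \<phi>(((x - t) \<bullet> sgn u) / h)\<close> belong to the class and all take the same value at \<open>t\<close>, of
  order \<open>L h\<^sup>\<beta>\<close>. Each is visible only on a slab of width of order \<open>h\<close> through \<open>t\<close>. If \<open>u\<close> were known,
  then \<open>F\<^sub>u\<close> could be told apart from zero as soon as \<open>n L\<^sup>2 h\<^sup>2\<^sup>\<beta>\<^sup>+\<^sup>1\<close>, the information in one slab, is
  large. The logarithm in the rate is the price for not knowing \<open>u\<close>.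

  To see this, draw \<open>u\<close> at random and test zero against the resulting mixture of laws. The mixture is
  hard to distinguish from zero if its chi-square integral, the average over two independent
  directions \<open>u, v\<close> of the integral of \<open>P\<^sub>u P\<^sub>v / P\<^sub>0\<close>, is bounded
  (\<open>risk_lower_bound_from_mixture\<close>). The shift condition on the noise bounds the integral for a pair by
  \<open>exp (n Q (L h\<^sup>\<beta>)\<^sup>2 M)\<close>, where \<open>M\<close> is the design mass of the intersection of the two slabs
  (\<open>chi_square_regression\<close>). There is a prior such that always \<open>M \<le> C\<^sub>1 h\<close>, while on average
  \<open>M\<close> is at most of order \<open>h\<^sup>3\<^sup>/\<^sup>2\<close>, since two random slabs share little mass (\<open>exists_direction_prior\<close>). This
  rests on the boundedness of the design density and on the dimension being at least 2.

  Now take \<open>n L\<^sup>2 h\<^sup>2\<^sup>\<beta>\<^sup>+\<^sup>1 = a ln n\<close>. The exponent is at most \<open>a Q C\<^sub>1 ln n\<close>, so the exponential is at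
  most a power of \<open>n\<close> whose exponent is as small as desired if \<open>a\<close> is small, and by \<open>e\<^sup>z \<le> 1 + z e\<^sup>z\<close> the chi-square
  integral exceeds 1 by at most this power times \<open>ln n\<close> times \<open>h\<^sup>1\<^sup>/\<^sup>2\<close>, which tends to 0 because \<open>h\<close> is
  polynomially small. Hence no estimator beats the separation \<open>L h\<^sup>\<beta>\<close>, which for this \<open>h\<close> is a constant
  multiple of the rate, and the constant does not depend on \<open>L\<close>.
\<close>

section \<open>Bumps in Holder classes\<close>

lemma smoothness_index_bounds:
  assumes "\<beta> > 0"
  shows "real (smoothness_index \<beta>) < \<beta>" and "\<beta> \<le> real (smoothness_index \<beta>) + 1"
proof -
  obtain N :: nat where N: "\<beta> \<le> real N" by (meson real_arch_simple)
  have bound: "m \<le> N" if "real m < \<beta>" for m using N that by linarith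
  show "real (smoothness_index \<beta>) < \<beta>"
    unfolding smoothness_index_def
    by (rule GreatestI_nat[where P="\<lambda>m. real m < \<beta>" and k=0 and b=N]) (use assms bound in simp_all)
  show "\<beta> \<le> real (smoothness_index \<beta>) + 1"
  proof (rule ccontr)
    assume "\<not> ?thesis"
    then have "real (Suc (smoothness_index \<beta>)) < \<beta>" by simp
    then have "Suc (smoothness_index \<beta>) \<le> smoothness_index \<beta>"
      using Greatest_le_nat[of "\<lambda>m. real m < \<beta>" _ N] bound unfolding smoothness_index_def by simp
    then show False by simp
  qed
qed

text \<open>At \<open>0\<close> the difference quotient is itself a truncated power, which is continuous and vanishes
  there (Caratheodory's form of differentiability).\<close>
lemma DERIV_truncated_power:
  "((\<lambda>y::real. max 0 y ^ Suc (Suc j)) has_field_derivative real (Suc (Suc j)) * max 0 y ^ Suc j) (at y)"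
proof -
  consider "y > 0" | "y < 0" | "y = 0" by linarith
  then show ?thesis
  proof cases
    case 1
    have "((\<lambda>y::real. y ^ Suc (Suc j)) has_field_derivative real (Suc (Suc j)) * y ^ Suc j) (at y)"
      by (rule derivative_eq_intros refl | simp)+
    then have "((\<lambda>y::real. max 0 y ^ Suc (Suc j)) has_field_derivative real (Suc (Suc j)) * y ^ Suc j) (at y)"
      by (rule has_field_derivative_transform_within_open[where S="{0<..}"]) (use 1 in \<open>auto simp: max_def\<close>)
    then show ?thesis using 1 by (simp add: max_def)
  next
    case 2
    have "((\<lambda>y::real. 0) has_field_derivative 0) (at y)" by simp
    then have "((\<lambda>y::real. max 0 y ^ Suc (Suc j)) has_field_derivative 0) (at y)"
      by (rule has_field_derivative_transform_within_open[where S="{..<0}"]) (use 2 in \<open>auto simp: max_def\<close>)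
    then show ?thesis using 2 by (simp add: max_def)
  next
    case 3
    have "max 0 z ^ Suc (Suc j) - max 0 (0::real) ^ Suc (Suc j) = max 0 z ^ Suc j * (z - 0)" for z :: real
      by (auto simp: max_def)
    moreover have "isCont (\<lambda>z::real. max 0 z ^ Suc j) 0" by (intro continuous_intros)
    ultimately show ?thesis unfolding CARAT_DERIV 3 by (intro exI[of _ "\<lambda>z. max 0 z ^ Suc j"]) auto
  qed
qed

text \<open>The functions \<open>p(x) (1 - x\<^sup>2)\<^sub>+\<^sup>j\<close> with a polynomial \<open>p\<close> are stable under differentiation, at the
  cost of one power. This is why a truncated polynomial serves as the bump: finitely many
  derivatives are needed, and this stability gives all of them at once.\<close>
lemma DERIV_poly_times_bump:
  fixes p :: "real poly"
  shows "((\<lambda>x. poly p x * max 0 (1 - x\<^sup>2) ^ Suc (Suc j)) has_field_derivative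
     poly (pderiv p * [:1, 0, -1:] + smult (- 2 * real (Suc (Suc j))) (pCons 0 p)) x
       * max 0 (1 - x\<^sup>2) ^ Suc j) (at x)"
proof -
  have chain: "((\<lambda>x. max 0 (1 - x\<^sup>2) ^ Suc (Suc j)) has_field_derivative
     (real (Suc (Suc j)) * max 0 (1 - x\<^sup>2) ^ Suc j) * (- 2 * x)) (at x)"
    by (rule DERIV_chain2[OF DERIV_truncated_power]) (rule derivative_eq_intros refl | simp)+
  have eq: "max 0 (1 - x\<^sup>2) ^ Suc (Suc j) = (1 - x\<^sup>2) * max 0 (1 - x\<^sup>2) ^ Suc j"
    by (auto simp: max_def)
  show ?thesis
    by (rule DERIV_cong[OF DERIV_mult[OF poly_DERIV chain]])
       (unfold eq, simp add: algebra_simps power2_eq_square)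
qed

lemma higher_deriv_bump:
  assumes "k \<le> Suc m"
  shows "\<exists>p. (deriv ^^ k) (\<lambda>x::real. max 0 (1 - x\<^sup>2) ^ (m + 2)) =
     (\<lambda>x. poly p x * max 0 (1 - x\<^sup>2) ^ (m + 2 - k))"
  using assms
proof (induction k)
  case 0
  show ?case by (rule exI[of _ 1]) simp
next
  case (Suc k)
  then obtain p where p: "(deriv ^^ k) (\<lambda>x::real. max 0 (1 - x\<^sup>2) ^ (m + 2)) =
     (\<lambda>x. poly p x * max 0 (1 - x\<^sup>2) ^ (m + 2 - k))" by auto
  obtain j where j: "m = j + k" using Suc.prems by (metis Suc_le_mono le_add_diff_inverse2)
  then have e: "m + 2 - k = Suc (Suc j)" "m + 2 - Suc k = Suc j" by auto
  have "(deriv ^^ Suc k) (\<lambda>x::real. max 0 (1 - x\<^sup>2) ^ (m + 2)) =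
      deriv (\<lambda>x. poly p x * max 0 (1 - x\<^sup>2) ^ Suc (Suc j))"
    using p unfolding e by (simp only: funpow.simps o_apply)
  also have "\<dots> = (\<lambda>x. poly (pderiv p * [:1, 0, -1:] + smult (- 2 * real (Suc (Suc j))) (pCons 0 p)) x
       * max 0 (1 - x\<^sup>2) ^ Suc j)"
    by (rule ext) (rule DERIV_imp_deriv[OF DERIV_poly_times_bump])
  finally show ?case unfolding e by (rule exI)
qed

lemma bump_derivatives:
  fixes m :: nat
  defines "\<phi> \<equiv> (\<lambda>x::real. max 0 (1 - x\<^sup>2) ^ (m + 2))"
  shows "k \<le> m \<Longrightarrow> (deriv ^^ k) \<phi> differentiable (at x)"
    and "\<exists>B. \<forall>k\<le>Suc m. \<forall>x. \<bar>(deriv ^^ k) \<phi> x\<bar> \<le> B"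
proof -
  show "(deriv ^^ k) \<phi> differentiable (at x)" if k: "k \<le> m" for k x
  proof -
    obtain p where p: "(deriv ^^ k) \<phi> = (\<lambda>x. poly p x * max 0 (1 - x\<^sup>2) ^ (m + 2 - k))"
      using higher_deriv_bump[of k m] k unfolding \<phi>_def by auto
    obtain j where j: "m = j + k" using k by (metis le_add_diff_inverse2)
    then have e: "m + 2 - k = Suc (Suc j)" by auto
    show ?thesis unfolding p e real_differentiable_def using DERIV_poly_times_bump by blast
  qed
  have "\<exists>B. \<forall>x. \<bar>(deriv ^^ k) \<phi> x\<bar> \<le> B" if k: "k \<le> Suc m" for k
  proof -
    obtain p where p: "(deriv ^^ k) \<phi> = (\<lambda>x. poly p x * max 0 (1 - x\<^sup>2) ^ (m + 2 - k))"
      using higher_deriv_bump[of k m] k unfolding \<phi>_def by auto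
    have "bounded ((\<lambda>x. poly p x * max 0 (1 - x\<^sup>2) ^ (m + 2 - k)) ` {-1..1})"
      by (intro compact_imp_bounded compact_continuous_image continuous_intros) auto
    then obtain B where B: "\<forall>x\<in>{-1..1}. \<bar>poly p x * max 0 (1 - x\<^sup>2) ^ (m + 2 - k)\<bar> \<le> B"
      unfolding bounded_iff by (auto simp only: real_norm_def ball_simps image_iff)
    have "\<bar>poly p x * max 0 (1 - x\<^sup>2) ^ (m + 2 - k)\<bar> \<le> max B 0" for x
    proof (cases "x \<in> {-1..1}")
      case False
      then have "\<bar>x\<bar> \<ge> 1" by auto
      then have "1 - x\<^sup>2 \<le> 0" using abs_le_square_iff[of 1 x] by simp
      then have "max 0 (1 - x\<^sup>2) ^ (m + 2 - k) = 0" using k by (simp only: max_absorb1) simp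
      then show ?thesis by (simp only: mult_zero_right abs_zero max.cobounded2)
    qed (use B in force)
    then show ?thesis unfolding p by blast
  qed
  then have "\<forall>k. \<exists>B. k \<le> Suc m \<longrightarrow> (\<forall>x. \<bar>(deriv ^^ k) \<phi> x\<bar> \<le> B)" by blast
  from choice[OF this] obtain B
    where B: "\<forall>k. k \<le> Suc m \<longrightarrow> (\<forall>x. \<bar>(deriv ^^ k) \<phi> x\<bar> \<le> B k)" ..
  have "\<bar>(deriv ^^ k) \<phi> x\<bar> \<le> Max (B ` {..Suc m})" if "k \<le> Suc m" for k x
  proof -
    have "B k \<le> Max (B ` {..Suc m})" using that by (intro Max_ge) auto
    with B[rule_format, OF that, of x] show ?thesis by (rule order_trans)
  qed
  then show "\<exists>B. \<forall>k\<le>Suc m. \<forall>x. \<bar>(deriv ^^ k) \<phi> x\<bar> \<le> B" by (intro exI[of _ "Max (B ` {..Suc m})"] allI impI)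
qed

lemma DERIV_affine_argument:
  fixes f :: "real \<Rightarrow> real"
  assumes "f differentiable (at ((w - a) / h))"
  shows "((\<lambda>w. c * f ((w - a) / h)) has_field_derivative c * (deriv f ((w - a) / h) * (1 / h))) (at w)"
proof (intro DERIV_cmult DERIV_chain2[where g="\<lambda>w. (w - a) / h"])
  show "(f has_field_derivative deriv f ((w - a) / h)) (at ((w - a) / h))"
    using assms by (simp add: DERIV_deriv_iff_real_differentiable)
  show "((\<lambda>w. (w - a) / h) has_field_derivative 1 / h) (at w)"
    unfolding divide_inverse by (auto intro!: derivative_eq_intros)
qed

text \<open>For \<open>k \<ge> 1\<close>, \<open>deriv\<close> is meaningful only where the function is differentiable, so the scaling rule
  stops at the order up to which \<open>\<phi>\<close> is known to be smooth.\<close>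
lemma higher_deriv_affine:
  fixes \<phi> :: "real \<Rightarrow> real"
  assumes "\<And>k x. k < m \<Longrightarrow> (deriv ^^ k) \<phi> differentiable (at x)" and "k \<le> m"
  shows "(deriv ^^ k) (\<lambda>w. c * \<phi> ((w - a) / h)) = (\<lambda>w. c / h ^ k * (deriv ^^ k) \<phi> ((w - a) / h))"
  using \<open>k \<le> m\<close>
proof (induction k)
  case (Suc k)
  have "deriv (\<lambda>w. c / h ^ k * (deriv ^^ k) \<phi> ((w - a) / h)) w =
     c / h ^ k * (deriv ((deriv ^^ k) \<phi>) ((w - a) / h) * (1 / h))" for w
    using assms(1)[of k] Suc.prems by (intro DERIV_imp_deriv DERIV_affine_argument) auto
  then show ?case using Suc by (auto simp: field_simps)
qed simp

text \<open>The \<open>k\<close>-th derivative of the rescaled function carries the factor \<open>h\<^sup>\<beta>\<^sup>-\<^sup>k\<close>. At the top order this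
  is exactly absorbed by the Holder increment, because \<open>\<bar>s / h\<bar>\<^sup>\<beta>\<^sup>-\<^sup>m = h\<^sup>m\<^sup>-\<^sup>\<beta> \<bar>s\<bar>\<^sup>\<beta>\<^sup>-\<^sup>m\<close>; at lower orders
  the factor is at most 1 because \<open>h \<le> 1\<close> and \<open>k < \<beta>\<close>.\<close>
lemma holder_class_rescale:
  fixes \<phi> :: "real \<Rightarrow> real"
  assumes \<phi>: "\<phi> \<in> holder_class \<beta> B" and "\<beta> > 0" "0 < h" "h \<le> 1" "L \<ge> 0" "B > 0"
  shows "(\<lambda>w. L / B * h powr \<beta> * \<phi> ((w - a) / h)) \<in> holder_class \<beta> L"
proof -
  define m where "m = smoothness_index \<beta>"
  define c where "c = L / B * h powr \<beta>"
  have m: "real m < \<beta>" "\<beta> \<le> real m + 1" using smoothness_index_bounds[OF \<open>\<beta> > 0\<close>] by (auto simp: m_def)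
  from \<phi> have diff: "\<And>k x. k < m \<Longrightarrow> (deriv ^^ k) \<phi> differentiable (at x)"
    and cont: "continuous_on UNIV ((deriv ^^ m) \<phi>)"
    and bd: "\<And>k x. k \<le> m \<Longrightarrow> \<bar>(deriv ^^ k) \<phi> x\<bar> \<le> B"
    and hol: "\<And>u s. s > 0 \<Longrightarrow> \<bar>(deriv ^^ m) \<phi> (u + s) - (deriv ^^ m) \<phi> u\<bar> \<le> B * s powr (\<beta> - real m)"
    by (auto simp: holder_class_def Let_def m_def)
  have eq: "(deriv ^^ k) (\<lambda>w. c * \<phi> ((w - a) / h)) = (\<lambda>w. c / h ^ k * (deriv ^^ k) \<phi> ((w - a) / h))"
    if "k \<le> m" for k
    using higher_deriv_affine[of m \<phi> k c a h] diff that by blast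
  have ck: "0 \<le> c / h ^ k" "c / h ^ k * B = L * h powr (\<beta> - real k)" for k
    using assms by (auto simp: c_def powr_diff powr_realpow)
  have d1: "(deriv ^^ k) (\<lambda>w. c * \<phi> ((w - a) / h)) differentiable (at u)" if "k < m" for k u
    unfolding eq[OF less_imp_le[OF that]]
    using DERIV_affine_argument[OF diff[OF that]] real_differentiable_def by blast
  have d2: "continuous_on UNIV ((deriv ^^ m) (\<lambda>w. c * \<phi> ((w - a) / h)))"
    unfolding eq[OF order_refl] using \<open>0 < h\<close>
    by (intro continuous_intros continuous_on_compose2[OF cont]) auto
  have d3: "\<bar>(deriv ^^ k) (\<lambda>w. c * \<phi> ((w - a) / h)) u\<bar> \<le> L" if "k \<le> m" for k u
  proof -
    have "\<bar>(deriv ^^ k) (\<lambda>w. c * \<phi> ((w - a) / h)) u\<bar> \<le> c / h ^ k * B"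
      unfolding eq[OF that] abs_mult using ck(1)[of k] bd[OF that] by (intro mult_mono) auto
    also have "\<dots> \<le> L" unfolding ck
      using m that assms by (intro mult_left_le powr_le1) auto
    finally show ?thesis .
  qed
  have d4: "\<bar>(deriv ^^ m) (\<lambda>w. c * \<phi> ((w - a) / h)) (u + s) - (deriv ^^ m) (\<lambda>w. c * \<phi> ((w - a) / h)) u\<bar>
      \<le> L * s powr (\<beta> - real m)" if "s > 0" for u s
  proof -
    have "\<bar>(deriv ^^ m) (\<lambda>w. c * \<phi> ((w - a) / h)) (u + s) - (deriv ^^ m) (\<lambda>w. c * \<phi> ((w - a) / h)) u\<bar>
       = c / h ^ m * \<bar>(deriv ^^ m) \<phi> ((u - a) / h + s / h) - (deriv ^^ m) \<phi> ((u - a) / h)\<bar>"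
    proof -
      have "(u + s - a) / h = (u - a) / h + s / h" by (simp add: add_divide_distrib diff_divide_distrib)
      then show ?thesis
        unfolding eq[OF order_refl] right_diff_distrib[symmetric] abs_mult using ck(1)[of m] by (simp only: abs_of_nonneg)
    qed
    also have "\<dots> \<le> c / h ^ m * (B * (s / h) powr (\<beta> - real m))"
      using hol[of "s / h"] that \<open>0 < h\<close> ck(1)[of m] by (intro mult_left_mono) auto
    also have "\<dots> = (c / h ^ m * B) * (s / h) powr (\<beta> - real m)" by simp
    also have "\<dots> = L * s powr (\<beta> - real m)"
      unfolding ck using that \<open>0 < h\<close> by (simp add: powr_divide)
    finally show ?thesis .
  qed
  have "(\<lambda>w. c * \<phi> ((w - a) / h)) \<in> holder_class \<beta> L"
    unfolding holder_class_def Let_def mem_Collect_eq m_def[symmetric] using d1 d2 d3 d4 by blast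
  then show ?thesis by (simp add: c_def)
qed

text \<open>The exponent \<open>m + 2\<close> leaves the derivative of order \<open>m + 1\<close> bounded. The derivative of order \<open>m\<close> is
  then bounded and Lipschitz, hence Holder of every exponent in \<open>(0, 1]\<close>: the Lipschitz bound serves
  increments up to 1, boundedness the others.\<close>
lemma exists_holder_bump:
  assumes "\<beta> > 0"
  obtains \<phi> :: "real \<Rightarrow> real" where "\<phi> \<in> holder_class \<beta> 1" "continuous_on UNIV \<phi>" "\<phi> 0 > 0"
    "\<And>x. \<bar>\<phi> x\<bar> \<le> indicator {-1..1} x"
proof -
  define m where "m = smoothness_index \<beta>"
  define \<phi> where "\<phi> = (\<lambda>x::real. max 0 (1 - x\<^sup>2) ^ (m + 2))"
  note sm = smoothness_index_bounds[OF assms, folded m_def]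
  note diff = bump_derivatives(1)[of _ m, folded \<phi>_def]
  from bump_derivatives(2)[of m, folded \<phi>_def]
  obtain B0 where B0: "\<forall>k\<le>Suc m. \<forall>x. \<bar>(deriv ^^ k) \<phi> x\<bar> \<le> B0" ..
  define B where "B = 2 * max 1 B0"
  have bound: "2 * \<bar>(deriv ^^ k) \<phi> x\<bar> \<le> B" if "k \<le> Suc m" for k x
    using B0[rule_format, OF that, of x] unfolding B_def by linarith
  have "B > 0" by (simp add: B_def)
  note B = this bound
  have hol: "\<bar>(deriv ^^ m) \<phi> (u + s) - (deriv ^^ m) \<phi> u\<bar> \<le> B * s powr (\<beta> - real m)" if s: "s > 0" for u s
  proof (cases "s \<le> 1")
    case True
    have "\<bar>(deriv ^^ m) \<phi> (u + s) - (deriv ^^ m) \<phi> u\<bar> \<le> B * \<bar>u + s - u\<bar>"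
    proof -
      have D: "((deriv ^^ m) \<phi> has_real_derivative (deriv ^^ Suc m) \<phi> z) (at z within UNIV)" for z
        using DERIV_deriv_iff_real_differentiable[THEN iffD2, OF diff[OF order_refl], of z]
        by (simp only: funpow.simps o_apply)
      have N: "norm ((deriv ^^ Suc m) \<phi> z) \<le> B" for z
        using B(2)[of "Suc m" z] unfolding real_norm_def by linarith
      show ?thesis
        using field_differentiable_bound[OF convex_UNIV D N UNIV_I UNIV_I, of "u + s" u]
        unfolding real_norm_def .
    qed
    also have "\<dots> \<le> B * s powr (\<beta> - real m)"
      using s True sm B powr_mono'[of "\<beta> - real m" 1 s] by (intro mult_left_mono) auto
    finally show ?thesis .
  next
    case False
    have "\<bar>(deriv ^^ m) \<phi> (u + s) - (deriv ^^ m) \<phi> u\<bar> \<le> B * 1"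
      using B(2)[of m "u + s"] B(2)[of m u] by auto
    also have "\<dots> \<le> B * s powr (\<beta> - real m)"
      using False sm B by (intro mult_left_mono ge_one_powr_ge_zero) auto
    finally show ?thesis .
  qed
  have "continuous_on UNIV ((deriv ^^ m) \<phi>)"
    by (intro continuous_at_imp_continuous_on ballI differentiable_imp_continuous_within diff order_refl)
  moreover have "\<bar>(deriv ^^ k) \<phi> u\<bar> \<le> B" if "k \<le> m" for k u
    using B(2)[of k u] that by linarith
  ultimately have "\<phi> \<in> holder_class \<beta> B"
    unfolding holder_class_def Let_def mem_Collect_eq m_def[symmetric] using hol diff by simp
  from holder_class_rescale[OF this assms, of 1 1 0] B
  have "(\<lambda>x. \<phi> x / B) \<in> holder_class \<beta> 1" by simp
  moreover have "continuous_on UNIV (\<lambda>x. \<phi> x / B)" unfolding \<phi>_def using B by (intro continuous_intros) auto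
  moreover have "\<phi> 0 / B > 0" using B by (simp add: \<phi>_def)
  moreover have "\<bar>\<phi> x / B\<bar> \<le> indicator {-1..1} x" for x
  proof (cases "x \<in> {-1..1}")
    case True
    then show ?thesis using B(2)[of 0 x] B(1) by simp
  next
    case False
    then have "\<bar>x\<bar> \<ge> 1" by auto
    then have "1 - x\<^sup>2 \<le> 0" using abs_le_square_iff[of 1 x] by simp
    then show ?thesis by (simp add: max_def \<phi>_def)
  qed
  ultimately show ?thesis by (rule that)
qed

section \<open>Random slabs through a point\<close>

lemma emeasure_lborel_vimage_plus:
  fixes A :: "'a::euclidean_space set"
  assumes "A \<in> sets borel"
  shows "emeasure lborel ((+) c -` A) = emeasure lborel A"
proof -
  have "emeasure lborel A = emeasure (distr lborel borel ((+) c)) A"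
    by (simp add: lborel_distr_plus)
  also have "\<dots> = emeasure lborel ((+) c -` A)"
    using assms by (subst emeasure_distr) auto
  finally show ?thesis ..
qed

text \<open>Let \<open>e = h / \<parallel>v\<parallel>\<close>. About \<open>1 / (3 e)\<close> translates of the slab along its normal, at mutual distance
  \<open>3 e\<close>, are pairwise disjoint and fit into the ball of radius 2. They all have the same volume, so
  each has volume at most of order \<open>e\<close>.\<close>
lemma slab_volume_le:
  fixes v :: "'a::euclidean_space"
  assumes "v \<noteq> 0" "h > 0"
  shows "emeasure lborel {u \<in> cball 0 1. \<bar>v \<bullet> u\<bar> \<le> h}
    \<le> ennreal (6 * measure lborel (cball (0::'a) 2) * (h / norm v))"
proof -
  define A where "A = {u \<in> cball (0::'a) 1. \<bar>v \<bullet> u\<bar> \<le> h}"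
  define V where "V = measure lborel (cball (0::'a) 2)"
  define w where "w = v /\<^sub>R norm v"
  define e where "e = h / norm v"
  have e: "e > 0" using assms by (simp add: e_def)
  have w: "norm w = 1" using assms by (simp add: w_def)
  have A_w: "A = {u \<in> cball 0 1. \<bar>w \<bullet> u\<bar> \<le> e}"
    using assms by (auto simp: A_def w_def e_def abs_mult field_simps)
  have [measurable]: "A \<in> sets borel"
    unfolding A_def by measurable
  have V: "emeasure lborel (cball (0::'a) 2) = ennreal V" unfolding V_def
    using emeasure_lborel_cball_finite[of "0::'a" 2] by (intro emeasure_eq_ennreal_measure) auto
  have V0: "V \<ge> 0" by (simp add: V_def)
  have "emeasure lborel A \<le> ennreal (6 * V * e)"
  proof (cases "e \<ge> 1 / 3")
    case True
    have "emeasure lborel A \<le> emeasure lborel (cball (0::'a) 2)"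
      by (intro emeasure_mono) (auto simp: A_def)
    also have "\<dots> \<le> ennreal (6 * V * e)"
      unfolding V using True V0 mult_left_mono[of 1 "6 * e" V] by (intro ennreal_leI) simp
    finally show ?thesis .
  next
    case False
    \<comment> \<open>the number of disjoint translates; \<open>K \<ge> 1 / (6 e)\<close> because \<open>K \<ge> 1\<close>\<close>
    define K where "K = nat \<lfloor>1 / (3 * e)\<rfloor>"
    have "1 < 1 / (3 * e)" using False e by (simp add: field_simps)
    define z where "z = \<lfloor>1 / (3 * e)\<rfloor>"
    have "1 \<le> z" using \<open>1 < 1 / (3 * e)\<close> unfolding z_def by linarith
    then have "real K = real_of_int z" unfolding K_def z_def[symmetric] by simp
    then have K: "1 \<le> real K" "real K \<le> 1 / (3 * e)" "1 / (3 * e) < real K + 1"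
      using \<open>1 \<le> z\<close> unfolding z_def by auto
    define T where "T k = (+) (- (3 * e * real k) *\<^sub>R w) -` A" for k :: nat
    have T_borel: "T k \<in> sets lborel" for k
      using measurable_sets[of "(+) (- (3 * e * real k) *\<^sub>R w)" borel borel A] unfolding T_def by simp
    have emT: "emeasure lborel (T k) = emeasure lborel A" for k
      unfolding T_def by (rule emeasure_lborel_vimage_plus) measurable
    have inner_T: "\<bar>w \<bullet> x - 3 * e * real k\<bar> \<le> e" if "x \<in> T k" for x k
    proof -
      have "w \<bullet> w = 1" using w by (simp add: dot_square_norm)
      then show ?thesis using that by (simp add: T_def A_w inner_add_right inner_diff_right)
    qed
    have disj: "disjoint_family_on T {..<K}"
    proof (unfold disjoint_family_on_def, intro ballI impI)
      fix i j :: nat assume "i \<noteq> j"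
      have "1 \<le> \<bar>real i - real j\<bar>" using \<open>i \<noteq> j\<close> by linarith
      then have gap: "3 * e \<le> \<bar>3 * e * real i - 3 * e * real j\<bar>"
        using e by (simp add: abs_mult flip: right_diff_distrib)
      show "T i \<inter> T j = {}"
      proof (rule ccontr)
        assume "\<not> ?thesis"
        then obtain x where "x \<in> T i" "x \<in> T j" by blast
        then show False using inner_T[of x i] inner_T[of x j] gap e by linarith
      qed
    qed
    have sub: "(\<Union>k<K. T k) \<subseteq> cball 0 2"
    proof
      fix x assume "x \<in> (\<Union>k<K. T k)"
      then obtain k where k: "k < K" "x \<in> T k" by blast
      have "norm x \<le> norm (- (3 * e * real k) *\<^sub>R w + x) + norm ((3 * e * real k) *\<^sub>R w)"
        using norm_triangle_ineq[of "- (3 * e * real k) *\<^sub>R w + x" "(3 * e * real k) *\<^sub>R w"] by simp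
      also have "\<dots> \<le> 1 + 3 * e * real k"
        using k(2) e w by (simp add: T_def A_def)
      also have "\<dots> \<le> 1 + 3 * e * (1 / (3 * e))"
        using k(1) K e by (intro add_left_mono mult_left_mono) auto
      finally show "x \<in> cball 0 2" using e by simp
    qed
    have "of_nat K * emeasure lborel A = (\<Sum>k<K. emeasure lborel (T k))"
      by (simp add: emT)
    also have "\<dots> = emeasure lborel (\<Union>k<K. T k)"
      using T_borel disj by (intro sum_emeasure) auto
    also have "\<dots> \<le> emeasure lborel (cball (0::'a) 2)"
      using sub by (intro emeasure_mono) auto
    finally have le: "of_nat K * emeasure lborel A \<le> ennreal V" unfolding V .
    have "1 / (3 * e) \<le> 2 * real K" using K by linarith
    then have "1 \<le> 6 * e * real K" using e by (simp add: divide_le_eq mult_ac)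
    then have "emeasure lborel A \<le> ennreal (6 * e * real K) * emeasure lborel A"
      using mult_right_mono[of 1 "ennreal (6 * e * real K)" "emeasure lborel A"] by simp
    also have "\<dots> = ennreal (6 * e) * (of_nat K * emeasure lborel A)"
      using e by (simp add: ennreal_mult ennreal_of_nat_eq_real_of_nat mult.assoc)
    also have "\<dots> \<le> ennreal (6 * e) * ennreal V" by (intro mult_left_mono le) simp
    also have "\<dots> = ennreal (6 * V * e)" using e V0 by (simp add: ennreal_mult[symmetric] mult_ac)
    finally show ?thesis .
  qed
  then show ?thesis unfolding A_def V_def e_def .
qed

text \<open>In dimension at least 2 the singularity \<open>\<parallel>x - t\<parallel>\<^sup>-\<^sup>3\<^sup>/\<^sup>2\<close> is integrable against a bounded density.
  The dyadic shell of radius \<open>2\<^sup>-\<^sup>k\<close> contributes at most a multiple of \<open>(2\<^sup>3\<^sup>/\<^sup>2)\<^sup>k (2\<^sup>-\<^sup>k)\<^sup>2 = (2\<^sup>-\<^sup>1\<^sup>/\<^sup>2)\<^sup>k\<close>,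
  which is summable; away from \<open>t\<close> the integrand is at most the density.\<close>
lemma nn_integral_inverse_norm_finite:
  fixes g :: "'a::euclidean_space \<Rightarrow> real" and t :: 'a
  assumes dim: "DIM('a) \<ge> 2" and g: "prob_density g" and bound: "\<And>x. g x \<le> G"
  shows "(\<integral>\<^sup>+ x. ennreal (g x) * ennreal (norm (x - t) powr (- (3 / 2))) \<partial>lborel) < \<infinity>"
proof -
  have [measurable]: "g \<in> borel_measurable borel" and g0: "\<And>x. 0 \<le> g x"
    using g by (auto simp: prob_density_def)
  interpret prob_space "density lborel g" using g by (simp add: prob_density_def)
  have g1: "(\<integral>\<^sup>+ x. ennreal (g x) \<partial>lborel) = 1"
    using emeasure_space_1 by (simp add: emeasure_density)
  have G0: "G \<ge> 0" using bound[of 0] g0[of 0] by linarith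
  define q :: real where "q = 2 powr (3 / 2)"
  define V where "V = unit_ball_vol (real DIM('a))"
  have V0: "V \<ge> 0" by (simp add: V_def)
  have q: "0 < q" "q < 4"
  proof -
    show "0 < q" by (simp add: q_def)
    have "q < 2 powr 2" unfolding q_def by (intro powr_less_mono) auto
    then show "q < 4" by (simp add: powr_numeral)
  qed
  have layer: "ennreal (g x) * ennreal (norm (x - t) powr (- (3 / 2))) \<le>
      ennreal (g x) + (\<Sum>k. ennreal (G * q ^ Suc k) * indicator (cball t ((1 / 2) ^ k)) x)" for x
  proof -
    define \<rho> where "\<rho> = norm (x - t)"
    consider "\<rho> = 0" | "\<rho> \<ge> 1" | "0 < \<rho>" "\<rho> < 1" unfolding \<rho>_def by fastforce
    then show ?thesis
    proof cases
      case 1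
      then show ?thesis unfolding \<rho>_def by simp
    next
      case 2
      then have "\<rho> powr (- (3 / 2)) \<le> 1" using powr_mono[of "- (3 / 2)" 0 \<rho>] by simp
      then have "ennreal (g x) * ennreal (\<rho> powr (- (3 / 2))) \<le> ennreal (g x) * 1"
        by (intro mult_left_mono) auto
      then show ?thesis unfolding \<rho>_def by (simp add: add_increasing2)
    next
      case 3
      obtain k :: nat where k: "(1 / 2) ^ Suc k < \<rho>" "\<rho> \<le> (1 / 2) ^ k"
      proof -
        obtain n where n: "(1 / 2 :: real) ^ n < \<rho>" using real_arch_pow_inv[of \<rho> "1/2"] 3 by auto
        define m where "m = (LEAST n. (1 / 2 :: real) ^ n < \<rho>)"
        have m: "(1 / 2) ^ m < \<rho>" unfolding m_def by (rule LeastI, rule n)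
        have "m \<noteq> 0" using m 3 by (cases m) auto
        then obtain k where mk: "m = Suc k" by (cases m) auto
        have "\<not> (1 / 2) ^ k < \<rho>" using not_less_Least[of k "\<lambda>n. (1 / 2 :: real) ^ n < \<rho>"] mk m_def by simp
        with m mk show ?thesis by (intro that[of k]) auto
      qed
      have "\<rho> powr (- (3 / 2)) \<le> ((1 / 2) ^ Suc k) powr (- (3 / 2))"
        using k(1) by (intro powr_mono2') auto
      also have "\<dots> = q ^ Suc k"
      proof -
        have "(1 / 2 :: real) powr (- (3 / 2)) = q" by (simp add: q_def powr_divide powr_minus_divide)
        then have *: "((1 / 2 :: real) ^ n) powr (- (3 / 2)) = q ^ n" for n
          by (induction n) (simp_all add: powr_mult del: times_divide_eq_left times_divide_eq_right)
        show ?thesis by (rule *)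
      qed
      finally have le: "g x * \<rho> powr (- (3 / 2)) \<le> G * q ^ Suc k"
        using bound[of x] g0[of x] G0 by (intro mult_mono) auto
      have "ennreal (g x) * ennreal (\<rho> powr (- (3 / 2))) = ennreal (g x * \<rho> powr (- (3 / 2)))"
        using g0 by (simp add: ennreal_mult)
      also have "\<dots> \<le> ennreal (G * q ^ Suc k) * indicator (cball t ((1 / 2) ^ k)) x"
        using k(2) le by (auto simp: \<rho>_def dist_norm norm_minus_commute intro!: ennreal_leI)
      also have "\<dots> \<le> (\<Sum>k. ennreal (G * q ^ Suc k) * indicator (cball t ((1 / 2) ^ k)) x)"
        (is "?a k \<le> suminf ?a")
        using sum_le_suminf[OF summableI, of "{k}" ?a] by (simp del: sum_mult_indicator)
      finally show ?thesis unfolding \<rho>_def by (simp add: add_increasing)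
    qed
  qed
  have [measurable]: "cball t r \<in> sets borel" for r by simp
  have "(\<integral>\<^sup>+ x. ennreal (g x) * ennreal (norm (x - t) powr (- (3 / 2))) \<partial>lborel)
     \<le> (\<integral>\<^sup>+ x. ennreal (g x) + (\<Sum>k. ennreal (G * q ^ Suc k) * indicator (cball t ((1 / 2) ^ k)) x) \<partial>lborel)"
    by (intro nn_integral_mono layer)
  also have "\<dots> = 1 + (\<Sum>k. ennreal (G * q ^ Suc k) * emeasure lborel (cball t ((1 / 2) ^ k)))"
    by (subst nn_integral_add, measurable)
       (simp_all only: g1 nn_integral_suminf borel_measurable_indicator borel_measurable_const
          borel_measurable_times_ennreal closed_cball borel_closed sets_lborel nn_integral_cmult_indicator)
  also have "\<dots> \<le> 1 + (\<Sum>k. ennreal (G * q * V * (q / 4) ^ k))"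
  proof (intro add_left_mono suminf_le allI summableI)
    fix k
    have "((1 / 2 :: real) ^ k) ^ DIM('a) \<le> ((1 / 2) ^ k) ^ 2"
      using dim by (intro power_decreasing) (auto simp: power_le_one)
    also have "\<dots> = (1 / 4) ^ k" by (simp add: power2_eq_square flip: power_mult_distrib)
    finally have "V * ((1 / 2 :: real) ^ k) ^ DIM('a) \<le> V * (1 / 4) ^ k" using V0 by (rule mult_left_mono)
    then have "ennreal (G * q ^ Suc k) * emeasure lborel (cball t ((1 / 2) ^ k))
       \<le> ennreal (G * q ^ Suc k) * ennreal (V * (1 / 4) ^ k)"
      by (intro mult_left_mono) (auto simp: emeasure_cball V_def[symmetric] intro!: ennreal_leI)
    also have "\<dots> = ennreal (G * q * V * (q / 4) ^ k)"
      using G0 q V0 by (simp add: ennreal_mult[symmetric] power_divide)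
    finally show "ennreal (G * q ^ Suc k) * emeasure lborel (cball t ((1 / 2) ^ k))
      \<le> ennreal (G * q * V * (q / 4) ^ k)" .
  qed
  also have "\<dots> < \<infinity>"
  proof -
    have "summable (\<lambda>k. G * q * V * (q / 4) ^ k)"
      using q by (intro summable_mult summable_geometric) auto
    then have "(\<Sum>k. ennreal (G * q * V * (q / 4) ^ k)) = ennreal (\<Sum>k. G * q * V * (q / 4) ^ k)"
      using G0 q V0 by (intro suminf_ennreal2) auto
    then show ?thesis by simp
  qed
  finally show ?thesis .
qed

lemma borel_measurable_sgn_inner [measurable]:
  fixes f h :: "'b \<Rightarrow> 'a::euclidean_space"
  assumes [measurable]: "f \<in> borel_measurable M" "h \<in> borel_measurable M"
  shows "(\<lambda>z. f z \<bullet> sgn (h z)) \<in> borel_measurable M"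
  unfolding sgn_div_norm by measurable

text \<open>The mass under \<open>g\<close> of the intersection of two slabs of half-width \<open>h\<close> around hyperplanes through
  \<open>t\<close>. The normals are \<open>sgn u\<close> and \<open>sgn u'\<close>, so that \<open>u\<close> may range over a ball with Lebesgue measure
  instead of over the sphere.\<close>
definition slab_overlap :: "('a::euclidean_space \<Rightarrow> real) \<Rightarrow> 'a \<Rightarrow> real \<Rightarrow> 'a \<Rightarrow> 'a \<Rightarrow> ennreal" where
  "slab_overlap g t h u u' = (\<integral>\<^sup>+ x. ennreal (g x) * (indicator {x. \<bar>(x - t) \<bullet> sgn u\<bar> \<le> h} x
     * indicator {x. \<bar>(x - t) \<bullet> sgn u'\<bar> \<le> h} x) \<partial>lborel)"

text \<open>For a fixed \<open>x\<close>, a random slab through \<open>t\<close> covers \<open>x\<close> with probability at most of order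
  \<open>min 1 (h / \<parallel>x - t\<parallel>)\<close>. Integrating over \<open>x\<close>, a single slab has average mass of order \<open>h\<close>, and the
  overlap of two independent slabs has average mass at most of order \<open>h\<^sup>3\<^sup>/\<^sup>2\<close>, because
  \<open>(min 1 z)\<^sup>2 \<le> z\<^sup>3\<^sup>/\<^sup>2\<close>. An individual slab can be much heavier than the average. Such directions
  are discarded: by Markov's inequality they fill at most half of the ball, and conditioning on the
  rest at most doubles probabilities.\<close>
lemma exists_direction_prior:
  fixes g :: "'a::euclidean_space \<Rightarrow> real" and t :: 'a
  assumes dim: "DIM('a) \<ge> 2" and g: "prob_density g" and bound: "\<And>x. g x \<le> G"
  obtains C\<^sub>1 C\<^sub>2 where "C\<^sub>1 > 0" "C\<^sub>2 > 0"
    "\<And>h. h > 0 \<Longrightarrow> \<exists>\<pi>. prob_space \<pi> \<and> sets \<pi> = sets borel \<and>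
       (AE u in \<pi>. u \<noteq> 0 \<and> slab_overlap g t h u u \<le> ennreal (C\<^sub>1 * h)) \<and>
       (\<integral>\<^sup>+ u. \<integral>\<^sup>+ u'. slab_overlap g t h u u' \<partial>\<pi> \<partial>\<pi>) \<le> ennreal (C\<^sub>2 * h powr (3 / 2))"
proof -
  define M where "M = slab_overlap g t"
  have [measurable]: "g \<in> borel_measurable borel" and g0: "\<And>x. 0 \<le> g x"
    using g by (auto simp: prob_density_def)
  interpret prob_space "density lborel g" using g by (simp add: prob_density_def)
  have g1: "(\<integral>\<^sup>+ x. ennreal (g x) \<partial>lborel) = 1"
    using emeasure_space_1 by (simp add: emeasure_density)
  define B where "B = cball (0::'a) 1"
  define V where "V = measure lborel B"
  have V: "emeasure lborel B = ennreal V" unfolding V_def B_def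
    using emeasure_lborel_cball_finite[of "0::'a" 1] by (intro emeasure_eq_ennreal_measure) auto
  have V0: "V > 0" unfolding V_def B_def by (simp add: content_cball)
  define c where "c = 6 * measure lborel (cball (0::'a) 2)"
  have c0: "c > 0" unfolding c_def by (simp add: content_cball)
  define N where "N h x = {u. \<bar>(x - t) \<bullet> sgn u\<bar> \<le> h}" for h and x :: 'a
  have N_borel [measurable]: "N h x \<in> sets borel" for h x unfolding N_def by measurable
  have slab: "emeasure lborel (B \<inter> N h x) \<le> ennreal (c * (h / norm (x - t)))" if "h > 0" "x \<noteq> t" for h x
  proof -
    have "\<bar>(x - t) \<bullet> u\<bar> \<le> h" if "u \<in> B" "u \<in> N h x" for u
    proof -
      have "u = norm u *\<^sub>R sgn u" by (cases "u = 0") (simp_all add: sgn_div_norm)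
      then have "\<bar>(x - t) \<bullet> u\<bar> = norm u * \<bar>(x - t) \<bullet> sgn u\<bar>"
        by (metis abs_mult abs_norm_cancel inner_scaleR_right)
      also have "\<dots> \<le> 1 * h" using that \<open>h > 0\<close> unfolding B_def N_def by (intro mult_mono) auto
      finally show ?thesis by simp
    qed
    then have "emeasure lborel (B \<inter> N h x) \<le> emeasure lborel {u \<in> cball 0 1. \<bar>(x - t) \<bullet> u\<bar> \<le> h}"
      by (intro emeasure_mono) (auto simp: B_def)
    also have "\<dots> \<le> ennreal (c * (h / norm (x - t)))"
      unfolding c_def using that by (intro slab_volume_le) auto
    finally show ?thesis .
  qed
  define T where "T = enn2real (\<integral>\<^sup>+ x. ennreal (g x) * ennreal (norm (x - t) powr (- (3 / 2))) \<partial>lborel)"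
  have T: "(\<integral>\<^sup>+ x. ennreal (g x) * ennreal (norm (x - t) powr (- (3 / 2))) \<partial>lborel) = ennreal T"
    unfolding T_def using nn_integral_inverse_norm_finite[OF dim g bound, of t] by simp
  have T0: "T \<ge> 0" by (simp add: T_def)
  have AE_ne: "AE x in lborel. x \<noteq> t" by (rule AE_lborel_singleton)
  have M_swap: "M h u u' = (\<integral>\<^sup>+ x. ennreal (g x) * (indicator (N h x) u * indicator (N h x) u') \<partial>lborel)" for h u u'
    unfolding M_def slab_overlap_def N_def by (intro nn_integral_cong) (auto split: split_indicator)
  define C\<^sub>1 where "C\<^sub>1 = 2 * c * (1 + T) / V"
  define C\<^sub>2 where "C\<^sub>2 = (2 * c / V) powr (3 / 2) * (T + 1)"
  show thesis
  proof (rule that[of C\<^sub>1 C\<^sub>2])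
    show C1: "C\<^sub>1 > 0" unfolding C\<^sub>1_def using c0 T0 V0 by (intro divide_pos_pos mult_pos_pos) auto
    show C2: "C\<^sub>2 > 0" unfolding C\<^sub>2_def using c0 T0 V0 by (intro mult_pos_pos) auto
    fix h :: real assume h: "h > 0"
    have [measurable]: "(\<lambda>u. M h u u) \<in> borel_measurable borel"
      unfolding M_swap N_def indicator_def by measurable
    have "(\<integral>\<^sup>+ u. M h u u * indicator B u \<partial>lborel)
       = (\<integral>\<^sup>+ u. \<integral>\<^sup>+ x. ennreal (g x) * indicator (B \<inter> N h x) u \<partial>lborel \<partial>lborel)"
      unfolding M_swap by (subst nn_integral_multc[symmetric])
         (auto intro!: nn_integral_cong simp: N_def split: split_indicator)
    also have "\<dots> = (\<integral>\<^sup>+ x. \<integral>\<^sup>+ u. ennreal (g x) * indicator (B \<inter> N h x) u \<partial>lborel \<partial>lborel)"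
      unfolding N_def B_def indicator_def Int_iff mem_Collect_eq mem_cball
      by (rule lborel_pair.Fubini') measurable
    also have "\<dots> = (\<integral>\<^sup>+ x. ennreal (g x) * emeasure lborel (B \<inter> N h x) \<partial>lborel)"
      by (intro nn_integral_cong nn_integral_cmult_indicator) (simp add: B_def)
    also have "\<dots> \<le> (\<integral>\<^sup>+ x. ennreal (c * h) * (ennreal (g x) + ennreal (g x) * ennreal (norm (x - t) powr (- (3 / 2)))) \<partial>lborel)"
    proof (rule nn_integral_mono_AE, rule AE_mp[OF AE_ne], intro AE_I2 impI)
      fix x assume x: "x \<noteq> t"
      define \<rho> where "\<rho> = norm (x - t)"
      have \<rho>: "\<rho> > 0" using x by (simp add: \<rho>_def)
      have "1 / \<rho> \<le> 1 + \<rho> powr (- (3 / 2))"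
      proof (cases "\<rho> \<ge> 1")
        case True
        then have "1 / \<rho> \<le> 1" by simp
        then show ?thesis by (rule order_trans) simp
      next
        case False
        then have "\<rho> powr (- 1) \<le> \<rho> powr (- (3 / 2))" using \<rho> by (intro powr_mono') auto
        then show ?thesis using \<rho> by (simp add: powr_minus_divide)
      qed
      then have "ennreal (c * (h / \<rho>)) \<le> ennreal (c * h * (1 + \<rho> powr (- (3 / 2))))"
        using c0 h \<rho> mult_left_mono[of "1 / \<rho>" "1 + \<rho> powr (- (3 / 2))" "c * h"] by (intro ennreal_leI) simp
      with slab[OF h x] have "emeasure lborel (B \<inter> N h x) \<le> ennreal (c * h * (1 + \<rho> powr (- (3 / 2))))"
        unfolding \<rho>_def by (rule order_trans)
      then have "ennreal (g x) * emeasure lborel (B \<inter> N h x) \<le> ennreal (g x) * ennreal (c * h * (1 + \<rho> powr (- (3 / 2))))"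
        by (rule mult_left_mono) simp
      also have "\<dots> = ennreal (c * h) * (ennreal (g x) + ennreal (g x) * ennreal (\<rho> powr (- (3 / 2))))"
        using c0 h g0[of x] by (simp add: ennreal_mult'[symmetric] ennreal_plus[symmetric] algebra_simps del: ennreal_plus)
      finally show "ennreal (g x) * emeasure lborel (B \<inter> N h x) \<le> ennreal (c * h) *
         (ennreal (g x) + ennreal (g x) * ennreal (norm (x - t) powr (- (3 / 2))))" unfolding \<rho>_def .
    qed
    also have "\<dots> = ennreal (c * h) * (1 + ennreal T)"
      by (simp add: nn_integral_cmult nn_integral_add g1 T)
    also have "\<dots> = ennreal (c * h * (1 + T))"
      using c0 h T0 by (simp add: ennreal_mult' ennreal_plus[symmetric] flip: ennreal_1 del: ennreal_plus)
    finally have int_M: "(\<integral>\<^sup>+ u. M h u u * indicator B u \<partial>lborel) \<le> ennreal (c * h * (1 + T))" .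
    \<comment> \<open>the directions of heavy slabs, at most half of the ball by the choice of \<open>C\<^sub>1\<close>\<close>
    define Bad where "Bad = {u \<in> B. ennreal (C\<^sub>1 * h) < M h u u}"
    define S where "S = B - Bad - {0}"
    have [measurable]: "B \<in> sets borel" by (simp add: B_def)
    have [measurable]: "Bad \<in> sets borel" unfolding Bad_def by measurable
    have S_meas [measurable]: "S \<in> sets borel" by (simp add: S_def)
    have "ennreal (C\<^sub>1 * h) * emeasure lborel Bad = (\<integral>\<^sup>+ u. ennreal (C\<^sub>1 * h) * indicator Bad u \<partial>lborel)"
      by (simp add: nn_integral_cmult_indicator)
    also have "\<dots> \<le> (\<integral>\<^sup>+ u. M h u u * indicator B u \<partial>lborel)"
      by (intro nn_integral_mono) (auto simp: Bad_def split: split_indicator)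
    also note int_M
    also have "c * h * (1 + T) = C\<^sub>1 * h * (V / 2)" using V0 by (simp add: C\<^sub>1_def)
    also have "ennreal \<dots> = ennreal (C\<^sub>1 * h) * ennreal (V / 2)"
      using C1 h V0 by (intro ennreal_mult) auto
    finally have "ennreal (C\<^sub>1 * h) * emeasure lborel Bad \<le> ennreal (C\<^sub>1 * h) * ennreal (V / 2)" .
    then have Bad: "emeasure lborel Bad \<le> ennreal (V / 2)"
      using C1 h by (subst (asm) ennreal_mult_le_mult_iff) auto
    have "ennreal V = emeasure lborel B" by (simp add: V)
    also have "\<dots> \<le> emeasure lborel (S \<union> (Bad \<union> {0}))"
      by (intro emeasure_mono) (auto simp: S_def)
    also have "\<dots> \<le> emeasure lborel S + (emeasure lborel Bad + emeasure lborel {0::'a})"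
      by (intro order_trans[OF emeasure_subadditive] add_left_mono emeasure_subadditive) auto
    also have "\<dots> \<le> emeasure lborel S + ennreal (V / 2)"
      using Bad by (simp add: add_left_mono)
    finally have "ennreal (V / 2) + ennreal (V / 2) \<le> emeasure lborel S + ennreal (V / 2)"
      using V0 by (simp add: ennreal_plus[symmetric] del: ennreal_plus)
    then have S_ge: "ennreal (V / 2) \<le> emeasure lborel S"
      using ennreal_add_left_cancel_le[of "ennreal (V / 2)"] by (simp add: add.commute)
    have S_le: "emeasure lborel S \<le> ennreal V"
      unfolding V[symmetric] by (intro emeasure_mono) (auto simp: S_def)
    have S_ne: "emeasure lborel S \<noteq> 0" "emeasure lborel S \<noteq> \<infinity>"
      using S_ge S_le V0 by (auto simp: top_unique)
    obtain s where s: "emeasure lborel S = ennreal s" "0 \<le> s"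
      using S_ne by (metis ennreal_cases infinity_ennreal_def)
    then have s0: "V / 2 \<le> s" using S_ge V0 by simp
    \<comment> \<open>the prior: \<open>u\<close> is uniform on the remaining directions\<close>
    define \<pi> where "\<pi> = uniform_measure lborel S"
    have sets_\<pi> [measurable_cong]: "sets \<pi> = sets borel" by (simp add: \<pi>_def)
    have prob_\<pi>: "prob_space \<pi>" unfolding \<pi>_def using S_ne by (rule prob_space_uniform_measure)
    interpret \<pi>: prob_space \<pi> by (rule prob_\<pi>)
    interpret \<pi>_lborel: pair_sigma_finite \<pi> "lborel :: 'a measure" ..
    have AE_\<pi>: "AE u in \<pi>. u \<noteq> 0 \<and> M h u u \<le> ennreal (C\<^sub>1 * h)"
      unfolding \<pi>_def by (rule AE_uniform_measureI) (auto simp: S_def Bad_def not_less)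
    have \<pi>_N: "emeasure \<pi> (N h x) \<le> ennreal (2 * c / V * (h / norm (x - t)))" if "x \<noteq> t" for x
    proof -
      have "emeasure \<pi> (N h x) = emeasure lborel (S \<inter> N h x) / emeasure lborel S"
        by (simp add: \<pi>_def)
      also have "\<dots> \<le> ennreal (c * (h / norm (x - t))) / emeasure lborel S"
      proof (rule divide_right_mono_ennreal)
        have "emeasure lborel (S \<inter> N h x) \<le> emeasure lborel (B \<inter> N h x)"
          by (intro emeasure_mono) (auto simp: S_def)
        with slab[OF h that] show "emeasure lborel (S \<inter> N h x) \<le> ennreal (c * (h / norm (x - t)))"
          by simp
      qed
      also have "\<dots> = ennreal (c * (h / norm (x - t)) / s)"
        unfolding s(1) using c0 h s0 V0 by (intro divide_ennreal) auto
      also have "\<dots> \<le> ennreal (c * (h / norm (x - t)) / (V / 2))"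
        using c0 h s0 V0 by (intro ennreal_leI divide_left_mono) auto
      also have "c * (h / norm (x - t)) / (V / 2) = 2 * c / V * (h / norm (x - t))" by (simp add: mult_ac)
      finally show ?thesis .
    qed
    have "(\<integral>\<^sup>+ u. \<integral>\<^sup>+ u'. M h u u' \<partial>\<pi> \<partial>\<pi>)
       = (\<integral>\<^sup>+ u. \<integral>\<^sup>+ x. \<integral>\<^sup>+ u'. ennreal (g x) * (indicator (N h x) u * indicator (N h x) u') \<partial>\<pi> \<partial>lborel \<partial>\<pi>)"
      unfolding M_swap N_def indicator_def mem_Collect_eq
      by (intro nn_integral_cong \<pi>_lborel.Fubini'[symmetric]) measurable
    also have "\<dots> = (\<integral>\<^sup>+ x. \<integral>\<^sup>+ u. \<integral>\<^sup>+ u'. ennreal (g x) * (indicator (N h x) u * indicator (N h x) u') \<partial>\<pi> \<partial>\<pi> \<partial>lborel)"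
      unfolding N_def indicator_def mem_Collect_eq
      by (intro \<pi>_lborel.Fubini'[symmetric]) measurable
    also have "\<dots> = (\<integral>\<^sup>+ x. ennreal (g x) * (emeasure \<pi> (N h x) * emeasure \<pi> (N h x)) \<partial>lborel)"
      by (intro nn_integral_cong) (simp add: nn_integral_cmult nn_integral_multc)
    also have "\<dots> \<le> (\<integral>\<^sup>+ x. ennreal ((2 * c / V * h) powr (3 / 2)) *
       (ennreal (g x) * ennreal (norm (x - t) powr (- (3 / 2)))) \<partial>lborel)"
    proof (rule nn_integral_mono_AE, rule AE_mp[OF AE_ne], intro AE_I2 impI)
      fix x assume x: "x \<noteq> t"
      define \<rho> where "\<rho> = norm (x - t)"
      have \<rho>: "\<rho> > 0" using x by (simp add: \<rho>_def)
      define P where "P = measure \<pi> (N h x)"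
      define b where "b = 2 * c / V * h"
      have b0: "b > 0" using c0 V0 h by (simp add: b_def)
      have "ennreal P \<le> ennreal (b / \<rho>)"
        using \<pi>_N[OF x] unfolding P_def b_def \<rho>_def \<pi>.emeasure_eq_measure by simp
      then have "P \<le> b / \<rho>" using b0 \<rho> by (subst (asm) ennreal_le_iff) auto
      then have P: "0 \<le> P" "P \<le> 1" "P \<le> b / \<rho>" "emeasure \<pi> (N h x) = ennreal P"
        unfolding P_def by (auto simp: \<pi>.emeasure_eq_measure)
      have "P * P \<le> P powr (3 / 2)"
        using P powr_mono'[of "3/2" 2 P] by (simp add: powr_numeral power2_eq_square)
      also have "\<dots> \<le> (b / \<rho>) powr (3 / 2)" using P by (intro powr_mono2) auto
      also have "\<dots> = b powr (3 / 2) * \<rho> powr (- (3 / 2))"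
        using b0 \<rho> by (simp add: powr_divide powr_minus_divide)
      finally have "g x * (P * P) \<le> g x * (b powr (3 / 2) * \<rho> powr (- (3 / 2)))"
        using g0[of x] by (rule mult_left_mono)
      then show "ennreal (g x) * (emeasure \<pi> (N h x) * emeasure \<pi> (N h x)) \<le>
         ennreal ((2 * c / V * h) powr (3 / 2)) * (ennreal (g x) * ennreal (norm (x - t) powr (- (3 / 2))))"
        unfolding b_def[symmetric] \<rho>_def[symmetric] P(4) using g0[of x] P(1)
        by (simp add: ennreal_mult'[symmetric] mult_ac)
    qed
    also have "\<dots> = ennreal ((2 * c / V * h) powr (3 / 2) * T)"
      using T0 by (simp add: nn_integral_cmult T ennreal_mult')
    also have "\<dots> \<le> ennreal (C\<^sub>2 * h powr (3 / 2))"
      using c0 V0 h T0 unfolding C\<^sub>2_def powr_mult by (intro ennreal_leI) (simp add: powr_mult algebra_simps)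
    finally have "(\<integral>\<^sup>+ u. \<integral>\<^sup>+ u'. M h u u' \<partial>\<pi> \<partial>\<pi>) \<le> ennreal (C\<^sub>2 * h powr (3 / 2))" .
    with prob_\<pi> sets_\<pi> AE_\<pi> show "\<exists>\<pi>. prob_space \<pi> \<and> sets \<pi> = sets borel
       \<and> (AE u in \<pi>. u \<noteq> 0 \<and> slab_overlap g t h u u \<le> ennreal (C\<^sub>1 * h))
       \<and> (\<integral>\<^sup>+ u. \<integral>\<^sup>+ u'. slab_overlap g t h u u' \<partial>\<pi> \<partial>\<pi>) \<le> ennreal (C\<^sub>2 * h powr (3 / 2))"
      unfolding M_def by blast
  qed
qed

section \<open>The law of the sample\<close>

text \<open>Finiteness of the denominators excludes \<open>0 * \<infinity>\<close>, at which inversion of a product breaks down.\<close>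
lemma prod_divide_ennreal:
  fixes a b :: "'i \<Rightarrow> ennreal"
  assumes "\<And>i. i \<in> I \<Longrightarrow> b i < \<infinity>"
  shows "(\<Prod>i\<in>I. a i) / (\<Prod>i\<in>I. b i) = (\<Prod>i\<in>I. a i / b i)"
  using assms
proof (induction I rule: infinite_finite_induct)
  case (insert i I)
  have "(\<Prod>i\<in>I. b i) < top" using insert.prems by (auto simp: less_top[symmetric] ennreal_prod_eq_top)
  then have "inverse (b i * (\<Prod>i\<in>I. b i)) = inverse (b i) * inverse (\<Prod>i\<in>I. b i)"
    using insert.prems by (intro ennreal_inverse_mult) auto
  then show ?case using insert by (simp add: divide_ennreal_def mult_ac)
qed simp_all

lemma PiM_density:
  assumes "finite I" and sf: "\<And>i. sigma_finite_measure (M i)"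
    and f [measurable]: "\<And>i. f i \<in> borel_measurable (M i)"
    and prob: "\<And>i. prob_space (density (M i) (f i))"
  shows "density (PiM I M) (\<lambda>x. \<Prod>i\<in>I. f i (x i)) = PiM I (\<lambda>i. density (M i) (f i))"
proof -
  interpret M: product_sigma_finite M by (rule product_sigma_finite.intro) (rule sf)
  interpret N: product_prob_space "\<lambda>i. density (M i) (f i)" by (rule product_prob_spaceI) (rule prob)
  show ?thesis
  proof (rule N.PiM_eqI[OF \<open>finite I\<close>])
    show "sets (density (PiM I M) (\<lambda>x. \<Prod>i\<in>I. f i (x i))) = sets (PiM I (\<lambda>i. density (M i) (f i)))"
      by (auto intro!: sets_PiM_cong)
    fix A assume "\<And>i. i \<in> I \<Longrightarrow> A i \<in> sets (density (M i) (f i))"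
    then have A [measurable]: "\<And>i. i \<in> I \<Longrightarrow> A i \<in> sets (M i)" by simp
    have [measurable]: "Pi\<^sub>E I A \<in> sets (PiM I M)" using \<open>finite I\<close> A by (rule sets_PiM_I_finite)
    have "emeasure (density (PiM I M) (\<lambda>x. \<Prod>i\<in>I. f i (x i))) (Pi\<^sub>E I A)
      = (\<integral>\<^sup>+ x. (\<Prod>i\<in>I. f i (x i)) * indicator (Pi\<^sub>E I A) x \<partial>PiM I M)"
      by (intro emeasure_density) measurable
    also have "\<dots> = (\<integral>\<^sup>+ x. (\<Prod>i\<in>I. f i (x i) * indicator (A i) (x i)) \<partial>PiM I M)"
    proof (intro nn_integral_cong)
      fix x assume "x \<in> space (PiM I M)"
      then have "x \<in> extensional I" by (simp add: space_PiM PiE_def)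
      then have "indicator (Pi\<^sub>E I A) x = (\<Prod>i\<in>I. indicator (A i) (x i) :: ennreal)"
        using \<open>finite I\<close> by (auto simp: indicator_def PiE_iff prod_zero_iff)
      then show "(\<Prod>i\<in>I. f i (x i)) * indicator (Pi\<^sub>E I A) x = (\<Prod>i\<in>I. f i (x i) * indicator (A i) (x i))"
        by (simp add: prod.distrib)
    qed
    also have "\<dots> = (\<Prod>i\<in>I. \<integral>\<^sup>+ x. f i x * indicator (A i) x \<partial>M i)"
      using \<open>finite I\<close> by (rule M.product_nn_integral_prod) measurable
    also have "\<dots> = (\<Prod>i\<in>I. emeasure (density (M i) (f i)) (A i))"
      by (intro prod.cong refl emeasure_density[symmetric]) auto
    finally show "emeasure (density (PiM I M) (\<lambda>x. \<Prod>i\<in>I. f i (x i))) (Pi\<^sub>E I A)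
      = (\<Prod>i\<in>I. emeasure (density (M i) (f i)) (A i))" .
  qed
qed

lemma distr_PiM_coordinatewise:
  assumes "finite I" and prob: "\<And>i. prob_space (M i)"
    and f [measurable]: "\<And>i. f i \<in> measurable (M i) (M' i)"
  shows "distr (PiM I M) (PiM I M') (\<lambda>x. \<lambda>i\<in>I. f i (x i)) = PiM I (\<lambda>i. distr (M i) (M' i) (f i))"
proof -
  interpret M: product_prob_space M by (rule product_prob_spaceI) (rule prob)
  have "prob_space (distr (M i) (M' i) (f i))" for i
    by (rule prob_space.prob_space_distr[OF prob f])
  then interpret N: product_prob_space "\<lambda>i. distr (M i) (M' i) (f i)" by (rule product_prob_spaceI)
  have meas: "(\<lambda>x. \<lambda>i\<in>I. f i (x i)) \<in> measurable (PiM I M) (PiM I M')" by measurable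
  show ?thesis
  proof (rule N.PiM_eqI[OF \<open>finite I\<close>])
    show "sets (distr (PiM I M) (PiM I M') (\<lambda>x. \<lambda>i\<in>I. f i (x i))) = sets (PiM I (\<lambda>i. distr (M i) (M' i) (f i)))"
      by (auto intro!: sets_PiM_cong)
    fix A assume "\<And>i. i \<in> I \<Longrightarrow> A i \<in> sets (distr (M i) (M' i) (f i))"
    then have A: "\<And>i. i \<in> I \<Longrightarrow> A i \<in> sets (M' i)" by simp
    have "(\<lambda>x. \<lambda>i\<in>I. f i (x i)) -` Pi\<^sub>E I A \<inter> space (PiM I M) = Pi\<^sub>E I (\<lambda>i. f i -` A i \<inter> space (M i))"
      by (auto simp: space_PiM PiE_iff extensional_def)
    then have "emeasure (distr (PiM I M) (PiM I M') (\<lambda>x. \<lambda>i\<in>I. f i (x i))) (Pi\<^sub>E I A)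
       = emeasure (PiM I M) (Pi\<^sub>E I (\<lambda>i. f i -` A i \<inter> space (M i)))"
      using meas sets_PiM_I_finite[OF \<open>finite I\<close> A] by (subst emeasure_distr) auto
    also have "\<dots> = (\<Prod>i\<in>I. emeasure (M i) (f i -` A i \<inter> space (M i)))"
      using \<open>finite I\<close> A by (intro M.emeasure_PiM) (auto intro: measurable_sets[OF f])
    also have "\<dots> = (\<Prod>i\<in>I. emeasure (distr (M i) (M' i) (f i)) (A i))"
      using A by (intro prod.cong refl emeasure_distr[symmetric] f)
    finally show "emeasure (distr (PiM I M) (PiM I M') (\<lambda>x. \<lambda>i\<in>I. f i (x i))) (Pi\<^sub>E I A)
       = (\<Prod>i\<in>I. emeasure (distr (M i) (M' i) (f i)) (A i))" .
  qed
qed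

lemma distr_density_shift:
  fixes p :: "real \<Rightarrow> real"
  assumes [measurable]: "p \<in> borel_measurable borel"
  shows "distr (density lborel p) lborel (\<lambda>e. c + e) = density lborel (\<lambda>y. ennreal (p (y - c)))"
proof (rule measure_eqI)
  fix A assume "A \<in> sets (distr (density lborel p) lborel (\<lambda>e. c + e))"
  then have [measurable]: "A \<in> sets borel" by simp
  have "emeasure (distr (density lborel p) lborel (\<lambda>e. c + e)) A
     = (\<integral>\<^sup>+ e. ennreal (p e) * indicator A (c + e) \<partial>lborel)"
    by (subst emeasure_distr, measurable, subst emeasure_density, measurable)
       (auto intro!: nn_integral_cong split: split_indicator)
  also have "\<dots> = (\<integral>\<^sup>+ y. ennreal (p (y - c)) * indicator A y \<partial>lborel)"
    using nn_integral_real_affine[of "\<lambda>y. ennreal (p (y - c)) * indicator A y" 1 c] by simp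
  also have "\<dots> = emeasure (density lborel (\<lambda>y. ennreal (p (y - c)))) A"
    by (subst emeasure_density) auto
  finally show "emeasure (distr (density lborel p) lborel (\<lambda>e. c + e)) A
     = emeasure (density lborel (\<lambda>y. ennreal (p (y - c)))) A" .
qed simp

text \<open>The density of the responses \<open>y\<^sub>1, \<dots>, y\<^sub>n\<close> given the values \<open>c\<^sub>i\<close> of the regression function at
  the design points. It is a density with respect to Lebesgue measure, which does not depend on \<open>c\<close>, so
  that different regression functions can be compared pointwise.\<close>
definition noise_likelihood :: "(real \<Rightarrow> real) \<Rightarrow> nat \<Rightarrow> (nat \<Rightarrow> real) \<Rightarrow> (nat \<Rightarrow> real) \<Rightarrow> ennreal" where
  "noise_likelihood p n c y = (\<Prod>i\<in>{1..n}. ennreal (p (y i - c i)))"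

lemma nn_integral_shifted_noise:
  assumes p: "prob_density p" and [measurable]: "f \<in> borel_measurable (PiM {1..n} (\<lambda>_. lborel))"
  shows "(\<integral>\<^sup>+ e. f (\<lambda>i\<in>{1..n}. c i + e i) \<partial>PiM {1..n} (\<lambda>_. density lborel p))
    = (\<integral>\<^sup>+ y. noise_likelihood p n c y * f y \<partial>PiM {1..n} (\<lambda>_. lborel))"
proof -
  have [measurable]: "p \<in> borel_measurable borel" and prob: "prob_space (density lborel p)"
    using p by (auto simp: prob_density_def)
  have prob': "prob_space (density lborel (\<lambda>y. ennreal (p (y - c i))))" for i
    unfolding distr_density_shift[symmetric, OF \<open>p \<in> borel_measurable borel\<close>]
    by (rule prob_space.prob_space_distr[OF prob]) simp
  have "distr (PiM {1..n} (\<lambda>_. density lborel p)) (PiM {1..n} (\<lambda>_. lborel)) (\<lambda>e. \<lambda>i\<in>{1..n}. c i + e i)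
     = PiM {1..n} (\<lambda>i. distr (density lborel p) lborel (\<lambda>e. c i + e))"
    by (rule distr_PiM_coordinatewise) (auto intro: prob)
  also have "\<dots> = PiM {1..n} (\<lambda>i. density lborel (\<lambda>y. ennreal (p (y - c i))))"
    by (simp add: distr_density_shift)
  also have "\<dots> = density (PiM {1..n} (\<lambda>_. lborel)) (noise_likelihood p n c)"
    unfolding noise_likelihood_def by (rule PiM_density[symmetric]) (auto intro: prob' lborel.sigma_finite_measure_axioms)
  finally have eq: "distr (PiM {1..n} (\<lambda>_. density lborel p)) (PiM {1..n} (\<lambda>_. lborel)) (\<lambda>e. \<lambda>i\<in>{1..n}. c i + e i)
     = density (PiM {1..n} (\<lambda>_. lborel)) (noise_likelihood p n c)" .
  have lik [measurable]: "noise_likelihood p n c \<in> borel_measurable (PiM {1..n} (\<lambda>_. lborel))"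
    unfolding noise_likelihood_def by measurable
  have "(\<integral>\<^sup>+ e. f (\<lambda>i\<in>{1..n}. c i + e i) \<partial>PiM {1..n} (\<lambda>_. density lborel p))
     = (\<integral>\<^sup>+ y. f y \<partial>distr (PiM {1..n} (\<lambda>_. density lborel p)) (PiM {1..n} (\<lambda>_. lborel)) (\<lambda>e. \<lambda>i\<in>{1..n}. c i + e i))"
    by (rule nn_integral_distr[symmetric]) measurable
  also have "\<dots> = (\<integral>\<^sup>+ y. noise_likelihood p n c y * f y \<partial>PiM {1..n} (\<lambda>_. lborel))"
    unfolding eq by (rule nn_integral_density) measurable
  finally show ?thesis .
qed

lemma emeasure_sample_law:
  fixes g :: "real^'d \<Rightarrow> real"
  assumes g: "prob_density g" and p: "prob_density p" and F [measurable]: "F \<in> borel_measurable borel"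
    and A: "A \<in> sets (sample_space n)"
  shows "emeasure (sample_law g p n F) A =
    (\<integral>\<^sup>+ x. \<integral>\<^sup>+ y. noise_likelihood p n (\<lambda>i. F (x i)) y * indicator A (\<lambda>i\<in>{1..n}. (x i, y i))
       \<partial>PiM {1..n} (\<lambda>_. lborel) \<partial>PiM {1..n} (\<lambda>_. density lborel g))"
proof -
  have [measurable]: "g \<in> borel_measurable borel" "p \<in> borel_measurable borel"
    and pp: "prob_space (density lborel p)"
    using g p by (auto simp: prob_density_def)
  interpret EI: prob_space "PiM {1..n} (\<lambda>_. density lborel p)" by (rule prob_space_PiM) (rule pp)
  let ?X = "PiM {1..n} (\<lambda>_. density lborel g)" and ?E = "PiM {1..n} (\<lambda>_. density lborel p)"
  let ?s = "\<lambda>(x, e). \<lambda>i\<in>{1..n}. (x i, F (x i) + e i)"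
  have s [measurable]: "?s \<in> measurable (?X \<Otimes>\<^sub>M ?E) (sample_space n)"
    unfolding borel_prod[symmetric] by measurable
  note A [measurable]
  have "emeasure (sample_law g p n F) A = (\<integral>\<^sup>+ z. indicator A z \<partial>sample_law g p n F)"
    using A by (simp add: sample_law_def)
  also have "\<dots> = (\<integral>\<^sup>+ z. indicator A (?s z) \<partial>(?X \<Otimes>\<^sub>M ?E))"
    unfolding sample_law_def by (rule nn_integral_distr) measurable
  also have "\<dots> = (\<integral>\<^sup>+ x. \<integral>\<^sup>+ e. indicator A (?s (x, e)) \<partial>?E \<partial>?X)"
    by (rule EI.nn_integral_fst[symmetric]) measurable
  also have "\<dots> = (\<integral>\<^sup>+ x. \<integral>\<^sup>+ y. noise_likelihood p n (\<lambda>i. F (x i)) y * indicator A (\<lambda>i\<in>{1..n}. (x i, y i))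
       \<partial>PiM {1..n} (\<lambda>_. lborel) \<partial>?X)"
  proof (intro nn_integral_cong)
    fix x assume "x \<in> space ?X"
    have "(\<lambda>y. \<lambda>i\<in>{1..n}. (x i, y i)) \<in> measurable (PiM {1..n} (\<lambda>_. lborel)) (sample_space n)"
      unfolding borel_prod[symmetric] by measurable
    then have [measurable]: "(\<lambda>y. indicator A (\<lambda>i\<in>{1..n}. (x i, y i)) :: ennreal) \<in> borel_measurable (PiM {1..n} (\<lambda>_. lborel))"
      by measurable
    have "(\<integral>\<^sup>+ e. indicator A (?s (x, e)) \<partial>?E) =
      (\<integral>\<^sup>+ e. indicator A (\<lambda>i\<in>{1..n}. (x i, (\<lambda>i\<in>{1..n}. F (x i) + e i) i)) \<partial>?E)"
      by (intro nn_integral_cong arg_cong[where f="indicator A"]) auto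
    also have "\<dots> = (\<integral>\<^sup>+ y. noise_likelihood p n (\<lambda>i. F (x i)) y * indicator A (\<lambda>i\<in>{1..n}. (x i, y i))
       \<partial>PiM {1..n} (\<lambda>_. lborel))"
      using p by (rule nn_integral_shifted_noise) measurable
    finally show "(\<integral>\<^sup>+ e. indicator A (?s (x, e)) \<partial>?E) = (\<integral>\<^sup>+ y. noise_likelihood p n (\<lambda>i. F (x i)) y *
       indicator A (\<lambda>i\<in>{1..n}. (x i, y i)) \<partial>PiM {1..n} (\<lambda>_. lborel))" .
  qed
  finally show ?thesis .
qed

section \<open>Chi-square bounds and testing against a mixture\<close>

lemma chi_square_noise:
  assumes p: "prob_density p"
    and shift: "\<And>v w. \<bar>v\<bar> \<le> q \<Longrightarrow> \<bar>w\<bar> \<le> q \<Longrightarrow>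
      (\<integral>\<^sup>+ y. ennreal (p (y + v)) * ennreal (p (y + w)) / ennreal (p y) \<partial>lborel) \<le> ennreal (1 + Q * \<bar>v * w\<bar>)"
    and c: "\<And>i. \<bar>c i\<bar> \<le> q" "\<And>i. \<bar>d i\<bar> \<le> q"
  shows "(\<integral>\<^sup>+ y. noise_likelihood p n c y * noise_likelihood p n d y / noise_likelihood p n (\<lambda>_. 0) y
       \<partial>PiM {1..n} (\<lambda>_. lborel)) \<le> (\<Prod>i\<in>{1..n}. ennreal (1 + Q * \<bar>c i * d i\<bar>))"
proof -
  have [measurable]: "p \<in> borel_measurable borel" using p by (simp add: prob_density_def)
  interpret product_sigma_finite "\<lambda>_::nat. lborel :: real measure" ..
  have "(\<integral>\<^sup>+ y. noise_likelihood p n c y * noise_likelihood p n d y / noise_likelihood p n (\<lambda>_. 0) y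
       \<partial>PiM {1..n} (\<lambda>_. lborel))
    = (\<integral>\<^sup>+ y. (\<Prod>i\<in>{1..n}. ennreal (p (y i + - c i)) * ennreal (p (y i + - d i)) / ennreal (p (y i)))
       \<partial>PiM {1..n} (\<lambda>_. lborel))"
    unfolding noise_likelihood_def prod.distrib[symmetric]
    by (intro nn_integral_cong) (subst prod_divide_ennreal, auto)
  also have "\<dots> = (\<Prod>i\<in>{1..n}. \<integral>\<^sup>+ y. ennreal (p (y + - c i)) * ennreal (p (y + - d i)) / ennreal (p y) \<partial>lborel)"
    by (rule product_nn_integral_prod) measurable
  also have "\<dots> \<le> (\<Prod>i\<in>{1..n}. ennreal (1 + Q * \<bar>c i * d i\<bar>))"
  proof (intro prod_mono_ennreal)
    fix i
    show "(\<integral>\<^sup>+ y. ennreal (p (y + - c i)) * ennreal (p (y + - d i)) / ennreal (p y) \<partial>lborel)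
        \<le> ennreal (1 + Q * \<bar>c i * d i\<bar>)"
      using shift[of "- c i" "- d i"] c[of i] by simp
  qed
  finally show ?thesis .
qed

text \<open>The chi-square integral of the sample factorizes over the observations. Conditionally on the
  design, each factor is bounded by the shift inequality for the noise density.\<close>
lemma chi_square_regression:
  fixes g :: "real^'d \<Rightarrow> real"
  assumes g: "prob_density g" and p: "prob_density p" and "Q \<ge> 0"
    and shift: "\<And>v w. \<bar>v\<bar> \<le> q \<Longrightarrow> \<bar>w\<bar> \<le> q \<Longrightarrow>
      (\<integral>\<^sup>+ y. ennreal (p (y + v)) * ennreal (p (y + w)) / ennreal (p y) \<partial>lborel) \<le> ennreal (1 + Q * \<bar>v * w\<bar>)"
    and [measurable]: "F \<in> borel_measurable borel" "F' \<in> borel_measurable borel"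
    and F: "\<And>x. \<bar>F x\<bar> \<le> q" "\<And>x. \<bar>F' x\<bar> \<le> q"
  shows "(\<integral>\<^sup>+ x. \<integral>\<^sup>+ y. noise_likelihood p n (\<lambda>i. F (x i)) y * noise_likelihood p n (\<lambda>i. F' (x i)) y
       / noise_likelihood p n (\<lambda>_. 0) y \<partial>PiM {1..n} (\<lambda>_. lborel) \<partial>PiM {1..n} (\<lambda>_. density lborel g))
     \<le> (1 + ennreal Q * (\<integral>\<^sup>+ x. ennreal (g x) * ennreal \<bar>F x * F' x\<bar> \<partial>lborel)) ^ n"
proof -
  have [measurable]: "g \<in> borel_measurable borel" and pg: "prob_space (density lborel g)"
    using g by (auto simp: prob_density_def)
  interpret X: product_prob_space "\<lambda>_::nat. density lborel g" by (rule product_prob_spaceI) (rule pg)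
  have one: "emeasure (density lborel g) UNIV = 1" using X.M.emeasure_space_1 by simp
  have "(\<integral>\<^sup>+ x. \<integral>\<^sup>+ y. noise_likelihood p n (\<lambda>i. F (x i)) y * noise_likelihood p n (\<lambda>i. F' (x i)) y
       / noise_likelihood p n (\<lambda>_. 0) y \<partial>PiM {1..n} (\<lambda>_. lborel) \<partial>PiM {1..n} (\<lambda>_. density lborel g))
     \<le> (\<integral>\<^sup>+ x. (\<Prod>i\<in>{1..n}. ennreal (1 + Q * \<bar>F (x i) * F' (x i)\<bar>)) \<partial>PiM {1..n} (\<lambda>_. density lborel g))"
    using F by (intro nn_integral_mono chi_square_noise[OF p shift]) auto
  also have "\<dots> = (\<Prod>i\<in>{1..n}. \<integral>\<^sup>+ x. ennreal (1 + Q * \<bar>F x * F' x\<bar>) \<partial>density lborel g)"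
    by (rule X.product_nn_integral_prod) measurable
  also have "(\<integral>\<^sup>+ x. ennreal (1 + Q * \<bar>F x * F' x\<bar>) \<partial>density lborel g)
     = (\<integral>\<^sup>+ x. 1 + ennreal Q * ennreal \<bar>F x * F' x\<bar> \<partial>density lborel g)"
    using \<open>Q \<ge> 0\<close> by (intro nn_integral_cong) (simp add: ennreal_plus ennreal_mult)
  also have "\<dots> = 1 + ennreal Q * (\<integral>\<^sup>+ x. ennreal \<bar>F x * F' x\<bar> \<partial>density lborel g)"
    by (subst nn_integral_add, measurable) (simp add: one nn_integral_cmult)
  also have "(\<integral>\<^sup>+ x. ennreal \<bar>F x * F' x\<bar> \<partial>density lborel g)
     = (\<integral>\<^sup>+ x. ennreal (g x) * ennreal \<bar>F x * F' x\<bar> \<partial>lborel)"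
    by (rule nn_integral_density) measurable
  finally show ?thesis by simp
qed

text \<open>For positive reals this is the arithmetic-geometric mean inequality. It stays true in the extended
  sense at \<open>b = 0\<close>, because then \<open>a * a / b\<close> is \<open>\<infinity>\<close> unless \<open>a = 0\<close>. Thus laws can be compared without
  first showing absolute continuity.\<close>
lemma ennreal_le_weighted_square:
  fixes a b :: ennreal
  assumes "b < \<infinity>"
  shows "a \<le> 2 * b + a * a / b / 8"
proof (cases "a = 0 \<or> b = 0 \<or> a = \<infinity>")
  case True
  then show ?thesis using assms
    by (cases "a = 0") (auto simp: ennreal_top_mult ennreal_mult_top ennreal_top_divide divide_ennreal_def)
next
  case False
  then obtain x y where xy: "a = ennreal x" "b = ennreal y" "x > 0" "y > 0"
    using assms by (cases a; cases b) (auto simp: less_le)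
  have "0 \<le> (x - 4 * y)\<^sup>2" by simp
  then have "8 * (x * y) \<le> 16 * (y * y) + x * x" by (simp add: power2_eq_square algebra_simps)
  then have "x \<le> 2 * y + x * x / y / 8" using xy by (simp add: field_simps)
  then have "ennreal x \<le> ennreal (2 * y + x * x / y / 8)" by (rule ennreal_leI)
  also have "\<dots> = ennreal (2 * y) + ennreal (x * x / y / 8)"
    using xy by (intro ennreal_plus) auto
  also have "ennreal (2 * y) = 2 * b"
    using xy by (simp add: ennreal_mult)
  also have "ennreal (x * x / y / 8) = a * a / b / 8"
    using xy by (simp add: ennreal_mult[symmetric] divide_ennreal ennreal_divide_numeral del: divide_divide_eq_left)
  finally show ?thesis using xy by simp
qed

text \<open>With \<open>m = \<integral> q u d\<pi>(u)\<close> the density of the mixture, the inequality \<open>m \<le> 2 q0 + m\<^sup>2 / (8 q0)\<close> is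
  integrated over \<open>A\<close>. Expanding \<open>m\<^sup>2\<close> as a double integral turns the second term into the average of
  the pairwise chi-square integrals.\<close>
lemma mixture_event_bound:
  fixes q :: "'u \<Rightarrow> 'w \<Rightarrow> ennreal"
  assumes "sigma_finite_measure \<mu>" "sigma_finite_measure \<pi>"
    and [measurable]: "case_prod q \<in> borel_measurable (\<pi> \<Otimes>\<^sub>M \<mu>)" "q0 \<in> borel_measurable \<mu>" "A \<in> sets \<mu>"
    and fin: "\<And>z. q0 z < \<infinity>"
  shows "(\<integral>\<^sup>+ u. \<integral>\<^sup>+ z. q u z * indicator A z \<partial>\<mu> \<partial>\<pi>) \<le>
     2 * (\<integral>\<^sup>+ z. q0 z * indicator A z \<partial>\<mu>) + (\<integral>\<^sup>+ u. \<integral>\<^sup>+ u'. \<integral>\<^sup>+ z. q u z * q u' z / q0 z \<partial>\<mu> \<partial>\<pi> \<partial>\<pi>) / 8"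
proof -
  interpret \<mu>: sigma_finite_measure \<mu> by fact
  interpret \<pi>: sigma_finite_measure \<pi> by fact
  interpret pair_sigma_finite \<pi> \<mu> ..
  define m where "m z = (\<integral>\<^sup>+ u. q u z \<partial>\<pi>)" for z
  have [measurable]: "m \<in> borel_measurable \<mu>" unfolding m_def by measurable
  have "(\<integral>\<^sup>+ u. \<integral>\<^sup>+ z. q u z * indicator A z \<partial>\<mu> \<partial>\<pi>) = (\<integral>\<^sup>+ z. \<integral>\<^sup>+ u. q u z * indicator A z \<partial>\<pi> \<partial>\<mu>)"
    by (rule Fubini'[symmetric]) measurable
  also have "\<dots> = (\<integral>\<^sup>+ z. m z * indicator A z \<partial>\<mu>)"
    unfolding m_def by (intro nn_integral_cong nn_integral_multc) measurable
  also have "\<dots> \<le> (\<integral>\<^sup>+ z. 2 * (q0 z * indicator A z) + m z * m z / q0 z / 8 \<partial>\<mu>)"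
    using ennreal_le_weighted_square[OF fin, of "m _"] by (intro nn_integral_mono) (auto split: split_indicator)
  also have "\<dots> = 2 * (\<integral>\<^sup>+ z. q0 z * indicator A z \<partial>\<mu>) + (\<integral>\<^sup>+ z. m z * m z / q0 z \<partial>\<mu>) / 8"
    by (subst nn_integral_add, measurable) (simp add: nn_integral_cmult nn_integral_divide)
  also have "(\<integral>\<^sup>+ z. m z * m z / q0 z \<partial>\<mu>) = (\<integral>\<^sup>+ z. \<integral>\<^sup>+ u. \<integral>\<^sup>+ u'. q u z * q u' z / q0 z \<partial>\<pi> \<partial>\<pi> \<partial>\<mu>)"
  proof (intro nn_integral_cong)
    fix z assume [simp]: "z \<in> space \<mu>"
    have [measurable]: "(\<lambda>u. q u z) \<in> borel_measurable \<pi>" by measurable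
    have "(\<integral>\<^sup>+ u'. q u z * q u' z / q0 z \<partial>\<pi>) = q u z * m z / q0 z" for u
      unfolding m_def by (simp add: nn_integral_divide nn_integral_cmult)
    then show "m z * m z / q0 z = (\<integral>\<^sup>+ u. \<integral>\<^sup>+ u'. q u z * q u' z / q0 z \<partial>\<pi> \<partial>\<pi>)"
      by (simp add: nn_integral_divide nn_integral_multc) (simp add: m_def)
  qed
  also have "\<dots> = (\<integral>\<^sup>+ u. \<integral>\<^sup>+ z. \<integral>\<^sup>+ u'. q u z * q u' z / q0 z \<partial>\<pi> \<partial>\<mu> \<partial>\<pi>)"
    by (rule Fubini') measurable
  also have "\<dots> = (\<integral>\<^sup>+ u. \<integral>\<^sup>+ u'. \<integral>\<^sup>+ z. q u z * q u' z / q0 z \<partial>\<mu> \<partial>\<pi> \<partial>\<pi>)"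
    by (intro nn_integral_cong Fubini') measurable
  finally show ?thesis .
qed

lemma risk_ge_of_event:
  fixes g :: "real^'d \<Rightarrow> real"
  assumes [measurable]: "(\<lambda>\<omega>. T \<omega> t) \<in> borel_measurable (sample_space n)"
    and E: "E \<in> sets (sample_space n)" "\<And>\<omega>. \<omega> \<in> E \<Longrightarrow> s \<le> \<bar>T \<omega> t - F t\<bar>"
    and prob: "ennreal (1 / 4) \<le> emeasure (sample_law g p n F) E"
    and "s > 0" "r \<ge> 1"
  shows "ennreal (s / 4) \<le> risk g p n r t T F"
proof -
  define I where "I = (\<integral>\<^sup>+ \<omega>. ennreal (\<bar>T \<omega> t - F t\<bar> powr r) \<partial>sample_law g p n F)"
  have sets: "sets (sample_law g p n F) = sets (sample_space n)" by (simp add: sample_law_def)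
  have "ennreal (s powr r * (1 / 4)) \<le> ennreal (s powr r) * emeasure (sample_law g p n F) E"
    using prob by (subst ennreal_mult) (auto intro!: mult_left_mono)
  also have "\<dots> = (\<integral>\<^sup>+ \<omega>. ennreal (s powr r) * indicator E \<omega> \<partial>sample_law g p n F)"
    using E(1) by (simp add: nn_integral_cmult_indicator sets)
  also have "\<dots> \<le> I"
    unfolding I_def using E(2) \<open>s > 0\<close> \<open>r \<ge> 1\<close>
    by (intro nn_integral_mono) (auto split: split_indicator intro!: ennreal_leI powr_mono2)
  finally have I: "ennreal (s powr r * (1 / 4)) \<le> I" .
  have "ennreal (s / 4) \<le> ennreal_powr I (1 / r)"
  proof (cases I)
    case (real z)
    then have "s powr r * (1 / 4) \<le> z" using I by simp
    have "s / 4 = s * (1 / 4)" by simp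
    also have "\<dots> \<le> s * (1 / 4) powr (1 / r)"
      using \<open>s > 0\<close> \<open>r \<ge> 1\<close> powr_mono'[of "1 / r" 1 "1 / 4"] by (intro mult_left_mono) auto
    also have "\<dots> = (s powr r * (1 / 4)) powr (1 / r)"
      using \<open>s > 0\<close> \<open>r \<ge> 1\<close> by (simp add: powr_mult powr_powr powr_divide)
    also have "\<dots> \<le> z powr (1 / r)"
      using \<open>s powr r * (1 / 4) \<le> z\<close> \<open>r \<ge> 1\<close> by (intro powr_mono2) auto
    finally show ?thesis using real by (simp add: ennreal_powr_def ennreal_leI)
  qed (simp add: ennreal_powr_def)
  then show ?thesis by (simp add: risk_def I_def)
qed

text \<open>Testing zero against the mixture of the laws under \<open>F u\<close>. Let \<open>A\<close> be the event that the estimate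
  at \<open>t\<close> is at least \<open>s\<close> in modulus. On \<open>A\<close> the estimator errs by \<open>s\<close> if the truth is zero; off \<open>A\<close> it errs
  by \<open>s\<close> under every \<open>F u\<close>, whose value at \<open>t\<close> is \<open>2 s\<close>. If the chi-square integral of the mixture is
  at most 2, then the mixture gives \<open>A\<close> at most twice the probability under zero plus \<open>1 / 4\<close>. So
  either zero gives \<open>A\<close> probability at least \<open>1 / 4\<close>, or some \<open>F u\<close> gives the complement of \<open>A\<close>
  probability at least \<open>1 / 4\<close>.\<close>
lemma risk_lower_bound_from_mixture:
  fixes g :: "real^'d \<Rightarrow> real" and F :: "'u \<Rightarrow> real^'d \<Rightarrow> real"
  assumes g: "prob_density g" and p: "prob_density p" and \<pi>: "prob_space \<pi>"
    and F [measurable]: "(\<lambda>(u, x). F u x) \<in> borel_measurable (\<pi> \<Otimes>\<^sub>M borel)"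
    and cls: "(\<lambda>_. 0) \<in> \<F>" "AE u in \<pi>. F u \<in> \<F>" and Ft: "\<And>u. F u t = 2 * s"
    and "s > 0" "r \<ge> 1" and T: "T \<in> estimators n"
    and chi: "(\<integral>\<^sup>+ u. \<integral>\<^sup>+ u'. \<integral>\<^sup>+ x. \<integral>\<^sup>+ y. noise_likelihood p n (\<lambda>i. F u (x i)) y * noise_likelihood p n (\<lambda>i. F u' (x i)) y
       / noise_likelihood p n (\<lambda>_. 0) y \<partial>PiM {1..n} (\<lambda>_. lborel) \<partial>PiM {1..n} (\<lambda>_. density lborel g) \<partial>\<pi> \<partial>\<pi>) \<le> 2"
  shows "\<exists>f\<in>\<F>. ennreal (s / 4) \<le> risk g p n r t T f"
proof -
  have [measurable]: "g \<in> borel_measurable borel" "p \<in> borel_measurable borel"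
    and pg: "prob_space (density lborel g)" and pp: "prob_space (density lborel p)"
    using g p by (auto simp: prob_density_def)
  let ?X = "PiM {1..n} (\<lambda>_. density lborel g)" and ?Y = "PiM {1..n} (\<lambda>_. lborel :: real measure)"
  interpret X: prob_space ?X by (rule prob_space_PiM) (rule pg)
  interpret Yp: product_sigma_finite "\<lambda>_::nat. lborel :: real measure" ..
  interpret Y: sigma_finite_measure ?Y by (rule Yp.sigma_finite) simp
  interpret XY: pair_sigma_finite ?X ?Y ..
  interpret \<pi>: prob_space \<pi> by (rule \<pi>)
  have T [measurable]: "(\<lambda>\<omega>. T \<omega> t) \<in> borel_measurable (sample_space n)" using T by (simp add: estimators_def)
  have Fu [measurable]: "F u \<in> borel_measurable borel" if "u \<in> space \<pi>" for u
    using measurable_Pair2[OF F that] by simp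
  define A where "A = {\<omega> \<in> space (sample_space n). s \<le> \<bar>T \<omega> t\<bar>}"
  have A [measurable]: "A \<in> sets (sample_space n)" unfolding A_def by measurable
  define Ac where "Ac = space (sample_space n) - A"
  have Ac: "Ac \<in> sets (sample_space n)" unfolding Ac_def by (intro sets.compl_sets A)
  let ?smp = "\<lambda>(x, y). \<lambda>i\<in>{1..n}. (x i :: real^'d, y i :: real)"
  define B where "B = ?smp -` A \<inter> space (?X \<Otimes>\<^sub>M ?Y)"
  have smp [measurable]: "?smp \<in> measurable (?X \<Otimes>\<^sub>M ?Y) (sample_space n)"
    unfolding borel_prod[symmetric] by measurable
  have B [measurable]: "B \<in> sets (?X \<Otimes>\<^sub>M ?Y)" unfolding B_def by (rule measurable_sets[OF smp A])
  define q where "q u z = noise_likelihood p n (\<lambda>i. F u (fst z i)) (snd z)" for u and z :: "(nat \<Rightarrow> real^'d) \<times> (nat \<Rightarrow> real)"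
  define q0 where "q0 z = noise_likelihood p n (\<lambda>_. 0) (snd z)" for z :: "(nat \<Rightarrow> real^'d) \<times> (nat \<Rightarrow> real)"
  have q [measurable]: "case_prod q \<in> borel_measurable (\<pi> \<Otimes>\<^sub>M (?X \<Otimes>\<^sub>M ?Y))"
  proof -
    have [measurable]: "(\<lambda>w. F (fst w) (fst (snd w) i)) \<in> borel_measurable (\<pi> \<Otimes>\<^sub>M (?X \<Otimes>\<^sub>M ?Y))" if "i \<in> {1..n}" for i
    proof -
      have "(\<lambda>w. (fst w, fst (snd w) i)) \<in> measurable (\<pi> \<Otimes>\<^sub>M (?X \<Otimes>\<^sub>M ?Y)) (\<pi> \<Otimes>\<^sub>M borel)"
        using that by measurable
      from measurable_compose[OF this F] show ?thesis by simp
    qed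
    show ?thesis unfolding q_def noise_likelihood_def split_beta' by measurable
  qed
  have q0 [measurable]: "q0 \<in> borel_measurable (?X \<Otimes>\<^sub>M ?Y)" unfolding q0_def noise_likelihood_def by measurable
  have q0_fin: "q0 z < \<infinity>" for z unfolding q0_def noise_likelihood_def
    by (auto simp: less_top[symmetric] ennreal_prod_eq_top)
  have qu: "q u \<in> borel_measurable (?X \<Otimes>\<^sub>M ?Y)" if "u \<in> space \<pi>" for u
    using measurable_Pair2[OF q that] by simp
  \<comment> \<open>the law of the sample as a density on pairs of designs and responses; \<open>B\<close> is the event \<open>A\<close> there\<close>
  have law: "emeasure (sample_law g p n f) A = (\<integral>\<^sup>+ z. noise_likelihood p n (\<lambda>i. f (fst z i)) (snd z) * indicator B z \<partial>(?X \<Otimes>\<^sub>M ?Y))"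
    if f [measurable]: "f \<in> borel_measurable borel" for f
  proof -
    have m: "(\<lambda>z. noise_likelihood p n (\<lambda>i. f (fst z i)) (snd z) * indicator B z) \<in> borel_measurable (?X \<Otimes>\<^sub>M ?Y)"
      unfolding noise_likelihood_def by measurable
    show ?thesis
      unfolding emeasure_sample_law[OF g p f A] Y.nn_integral_fst[OF m, symmetric]
      by (intro nn_integral_cong arg_cong2[where f="(*)"]) (auto simp: B_def space_pair_measure split: split_indicator)
  qed
  have prob_law: "prob_space (sample_law g p n f)" if [measurable]: "f \<in> borel_measurable borel" for f
  proof -
    interpret E: prob_space "PiM {1..n} (\<lambda>_. density lborel p)" by (rule prob_space_PiM) (rule pp)
    interpret XE: pair_prob_space ?X "PiM {1..n} (\<lambda>_. density lborel p)" ..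
    show ?thesis unfolding sample_law_def
      by (rule XE.prob_space_distr) (unfold borel_prod[symmetric], measurable)
  qed
  have avg: "(\<integral>\<^sup>+ u. emeasure (sample_law g p n (F u)) A \<partial>\<pi>) \<le> 2 * emeasure (sample_law g p n (\<lambda>_. 0)) A + 2 / 8"
  proof -
    have "(\<integral>\<^sup>+ u. emeasure (sample_law g p n (F u)) A \<partial>\<pi>) = (\<integral>\<^sup>+ u. \<integral>\<^sup>+ z. q u z * indicator B z \<partial>(?X \<Otimes>\<^sub>M ?Y) \<partial>\<pi>)"
      unfolding q_def by (intro nn_integral_cong law Fu)
    also have "\<dots> \<le> 2 * (\<integral>\<^sup>+ z. q0 z * indicator B z \<partial>(?X \<Otimes>\<^sub>M ?Y)) +
        (\<integral>\<^sup>+ u. \<integral>\<^sup>+ u'. \<integral>\<^sup>+ z. q u z * q u' z / q0 z \<partial>(?X \<Otimes>\<^sub>M ?Y) \<partial>\<pi> \<partial>\<pi>) / 8"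
      by (intro mixture_event_bound q q0 B q0_fin XY.sigma_finite_measure_axioms \<pi>.sigma_finite_measure_axioms)
    also have "(\<integral>\<^sup>+ z. q0 z * indicator B z \<partial>(?X \<Otimes>\<^sub>M ?Y)) = emeasure (sample_law g p n (\<lambda>_. 0)) A"
      unfolding q0_def by (rule law[symmetric]) simp
    also have "(\<integral>\<^sup>+ u. \<integral>\<^sup>+ u'. \<integral>\<^sup>+ z. q u z * q u' z / q0 z \<partial>(?X \<Otimes>\<^sub>M ?Y) \<partial>\<pi> \<partial>\<pi>) \<le> 2"
    proof -
      have "(\<integral>\<^sup>+ u. \<integral>\<^sup>+ u'. \<integral>\<^sup>+ z. q u z * q u' z / q0 z \<partial>(?X \<Otimes>\<^sub>M ?Y) \<partial>\<pi> \<partial>\<pi>) =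
        (\<integral>\<^sup>+ u. \<integral>\<^sup>+ u'. \<integral>\<^sup>+ x. \<integral>\<^sup>+ y. q u (x, y) * q u' (x, y) / q0 (x, y) \<partial>?Y \<partial>?X \<partial>\<pi> \<partial>\<pi>)"
        by (intro nn_integral_cong Y.nn_integral_fst[symmetric] borel_measurable_divide_ennreal
              borel_measurable_times_ennreal qu q0)
      then show ?thesis using chi unfolding q_def q0_def by simp
    qed
    finally show ?thesis by (simp add: add_left_mono divide_right_mono_ennreal)
  qed
  show ?thesis
  proof (cases "ennreal (1 / 4) \<le> emeasure (sample_law g p n (\<lambda>_. 0)) A")
    case True
    have "ennreal (s / 4) \<le> risk g p n r t T (\<lambda>_. 0)"
      by (rule risk_ge_of_event[where T=T and t=t, OF T A _ True]) (use \<open>s > 0\<close> \<open>r \<ge> 1\<close> in \<open>auto simp: A_def\<close>)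
    then show ?thesis using cls(1) by blast
  next
    case False
    have "\<exists>u\<in>space \<pi>. F u \<in> \<F> \<and> emeasure (sample_law g p n (F u)) A \<le> ennreal (3 / 4)"
    proof (rule ccontr)
      assume none: "\<not> ?thesis"
      have "ennreal (3 / 4) = (\<integral>\<^sup>+ u. ennreal (3 / 4) \<partial>\<pi>)" by (simp add: \<pi>.emeasure_space_1)
      also have "\<dots> \<le> (\<integral>\<^sup>+ u. emeasure (sample_law g p n (F u)) A \<partial>\<pi>)"
        by (rule nn_integral_mono_AE, rule AE_mp[OF cls(2)], intro AE_I2 impI) (use none in force)
      also note avg
      finally have *: "ennreal (3 / 4) \<le> 2 * emeasure (sample_law g p n (\<lambda>_. 0)) A + 2 / 8" .
      interpret P0: prob_space "sample_law g p n (\<lambda>_. 0)" by (rule prob_law) simp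
      define a where "a = measure (sample_law g p n (\<lambda>_. 0)) A"
      have a: "emeasure (sample_law g p n (\<lambda>_. 0)) A = ennreal a" "a \<ge> 0"
        unfolding a_def by (auto simp: P0.emeasure_eq_measure)
      have "(2 / 8 :: ennreal) = ennreal 2 / ennreal 8" by simp
      also have "\<dots> = ennreal (2 / 8)" by (rule divide_ennreal) auto
      finally have "(2 / 8 :: ennreal) = ennreal (1 / 4)" by simp
      then have "ennreal (3 / 4) \<le> ennreal (2 * a + 1 / 4)"
        using * a by (simp add: ennreal_plus ennreal_mult)
      then have "3 / 4 \<le> 2 * a + 1 / 4" using a by (subst (asm) ennreal_le_iff) auto
      then have "1 / 4 \<le> a" by simp
      then show False using False a by simp
    qed
    then obtain u where u: "u \<in> space \<pi>" "F u \<in> \<F>" "emeasure (sample_law g p n (F u)) A \<le> ennreal (3 / 4)" by blast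
    interpret Pu: prob_space "sample_law g p n (F u)" by (rule prob_law) (rule Fu[OF u(1)])
    have sets: "sets (sample_law g p n (F u)) = sets (sample_space n)"
      "space (sample_law g p n (F u)) = space (sample_space n)" by (simp_all add: sample_law_def)
    have "measure (sample_law g p n (F u)) A \<le> 3 / 4" using u(3) by (simp add: Pu.emeasure_eq_measure)
    then have "1 / 4 \<le> measure (sample_law g p n (F u)) Ac"
      using Pu.prob_compl[of A] A unfolding Ac_def by (simp add: sets)
    then have Ac_prob: "ennreal (1 / 4) \<le> emeasure (sample_law g p n (F u)) Ac"
      unfolding Pu.emeasure_eq_measure by (rule ennreal_leI)
    have "ennreal (s / 4) \<le> risk g p n r t T (F u)"
      by (rule risk_ge_of_event[where T=T and t=t, OF T Ac _ Ac_prob \<open>s > 0\<close> \<open>r \<ge> 1\<close>]) (auto simp: Ft Ac_def A_def)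
    then show ?thesis using u(2) by blast
  qed
qed

section \<open>Random ridge functions\<close>

lemma zero_in_single_index_class:
  assumes "L \<ge> 0"
  shows "(\<lambda>_. 0) \<in> (single_index_class \<beta> L :: (real^'d \<Rightarrow> real) set)"
proof -
  have "(deriv ^^ k) (\<lambda>_::real. 0::real) = (\<lambda>_. 0)" for k by (induction k) auto
  then have "(\<lambda>_. 0) \<in> holder_class \<beta> L" using assms by (simp add: holder_class_def Let_def)
  moreover obtain \<theta> :: "real^'d" where "\<theta> \<in> Basis" using nonempty_Basis by blast
  then have "\<theta> \<in> sphere 0 1" by simp
  ultimately show ?thesis unfolding single_index_class_def by force
qed

text \<open>After \<open>1 + x \<le> e\<^sup>x\<close>, the inequality \<open>e\<^sup>z \<le> 1 + z e\<^sup>z\<close> is linear in \<open>z\<close> apart from a factor that is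
  bounded uniformly by \<open>exp b\<close>. So the average over random \<open>x\<close> needs only the mean of \<open>x\<close> and an
  upper bound for it.\<close>
lemma one_plus_power_le:
  fixes x b :: real
  assumes "x \<ge> 0" "real n * x \<le> b"
  shows "(1 + x) ^ n \<le> 1 + real n * x * exp b"
proof -
  have "(1 + x) ^ n \<le> exp x ^ n" using assms by (intro power_mono) (auto simp: exp_ge_add_one_self)
  also have "\<dots> = exp (real n * x)" by (simp add: exp_of_nat_mult)
  also have "exp (real n * x) \<le> 1 + real n * x * exp (real n * x)"
    using exp_ge_add_one_self[of "- (real n * x)"] mult_right_mono[of "1 - real n * x" "exp (- (real n * x))" "exp (real n * x)"]
    by (simp add: algebra_simps exp_minus)
  also have "\<dots> \<le> 1 + real n * x * exp b" using assms by (intro add_left_mono mult_left_mono) auto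
  finally show ?thesis .
qed

text \<open>The random alternatives are \<open>F u x = L h\<^sup>\<beta> \<phi>(((x - t) \<bullet> sgn u) / h)\<close>, supported on the slab of
  half-width \<open>h\<close> with normal \<open>sgn u\<close>. The chi-square integral of a pair is at most
  \<open>(1 + Q (L h\<^sup>\<beta>)\<^sup>2 slab_overlap)\<^sup>n\<close>. Overlaps are bounded by \<open>m\<close> and have mean at most \<open>e\<close>; the
  assumption \<open>info\<close> says that the mean, weighted by the exponential of the bound, keeps the
  chi-square integral of the mixture below 2.\<close>
lemma single_index_risk_lower_bound:
  fixes g :: "real^'d \<Rightarrow> real" and t :: "real^'d"
  assumes g: "prob_density g" and p: "prob_density p" and "Q \<ge> 0"
    and shift: "\<And>v w. \<bar>v\<bar> \<le> q \<Longrightarrow> \<bar>w\<bar> \<le> q \<Longrightarrow>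
      (\<integral>\<^sup>+ y. ennreal (p (y + v)) * ennreal (p (y + w)) / ennreal (p y) \<partial>lborel) \<le> ennreal (1 + Q * \<bar>v * w\<bar>)"
    and \<phi>: "\<phi> \<in> holder_class \<beta> 1" "continuous_on UNIV \<phi>" "\<phi> 0 > 0" "\<And>x. \<bar>\<phi> x\<bar> \<le> indicator {-1..1} x"
    and pos: "\<beta> > 0" "L > 0" "0 < h" "h \<le> 1" and small: "L * h powr \<beta> \<le> q"
    and \<pi>: "prob_space \<pi>" "sets \<pi> = sets borel"
      "AE u in \<pi>. u \<noteq> 0 \<and> slab_overlap g t h u u \<le> ennreal m"
      "(\<integral>\<^sup>+ u. \<integral>\<^sup>+ u'. slab_overlap g t h u u' \<partial>\<pi> \<partial>\<pi>) \<le> ennreal e"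
    and "m \<ge> 0" "e \<ge> 0"
    and info: "real n * Q * (L * h powr \<beta>)\<^sup>2 * exp (real n * Q * (L * h powr \<beta>)\<^sup>2 * m) * e \<le> 1"
    and "r \<ge> 1" and T: "T \<in> estimators n"
  shows "\<exists>F\<in>single_index_class \<beta> L. ennreal (L * h powr \<beta> * \<phi> 0 / 8) \<le> risk g p n r t T F"
proof -
  have [measurable]: "g \<in> borel_measurable borel" using g by (simp add: prob_density_def)
  have [measurable]: "\<phi> \<in> borel_measurable borel" using \<phi>(2) by (rule borel_measurable_continuous_onI)
  note [measurable_cong] = \<pi>(2)
  interpret \<pi>: prob_space \<pi> by (rule \<pi>)
  define A where "A = L * h powr \<beta>"
  have A: "0 < A" "A \<le> q" using pos small by (auto simp: A_def)
  define F where "F u x = A * \<phi> (((x - t) \<bullet> sgn u) / h)" for u x :: "real^'d"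
  have F_meas: "(\<lambda>(u, x). F u x) \<in> borel_measurable (\<pi> \<Otimes>\<^sub>M borel)" unfolding F_def by measurable
  have Fu [measurable]: "F u \<in> borel_measurable borel" for u unfolding F_def by measurable
  have F_bound: "\<bar>F u x\<bar> \<le> A * indicator {x. \<bar>(x - t) \<bullet> sgn u\<bar> \<le> h} x" for u x
  proof -
    have "\<bar>F u x\<bar> = A * \<bar>\<phi> (((x - t) \<bullet> sgn u) / h)\<bar>" using A by (simp add: F_def abs_mult)
    also have "\<dots> \<le> A * indicator {-1..1} (((x - t) \<bullet> sgn u) / h)"
      using A by (intro mult_left_mono \<phi>) auto
    also have "indicator {-1..1} (((x - t) \<bullet> sgn u) / h) = (indicator {x. \<bar>(x - t) \<bullet> sgn u\<bar> \<le> h} x :: real)"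
      using pos by (auto simp: indicator_def field_simps abs_le_iff)
    finally show ?thesis .
  qed
  have F_q: "\<bar>F u x\<bar> \<le> q" for u x
  proof -
    have "A * indicator {x. \<bar>(x - t) \<bullet> sgn u\<bar> \<le> h} x \<le> A * 1"
      using A by (intro mult_left_mono indicator_le_1) auto
    with F_bound[of u x] A show ?thesis by linarith
  qed
  have F_class: "F u \<in> single_index_class \<beta> L" if "u \<noteq> 0" for u
  proof -
    define f where "f = (\<lambda>w. L / 1 * h powr \<beta> * \<phi> ((w - t \<bullet> sgn u) / h))"
    have "f \<in> holder_class \<beta> L"
      unfolding f_def by (rule holder_class_rescale[OF \<phi>(1)]) (use pos in auto)
    moreover have "sgn u \<in> sphere 0 1" using that by (simp add: norm_sgn)
    moreover have "F u = (\<lambda>x. f (x \<bullet> sgn u))"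
      by (simp add: F_def f_def A_def inner_diff_left fun_eq_iff)
    ultimately show ?thesis unfolding single_index_class_def by blast
  qed
  define D where "D = real n * Q * A\<^sup>2"
  have D0: "D \<ge> 0" using \<open>Q \<ge> 0\<close> by (simp add: D_def)
  have S_meas [measurable]: "(\<lambda>u'. slab_overlap g t h u u') \<in> borel_measurable borel" for u
    unfolding slab_overlap_def indicator_def mem_Collect_eq by measurable
  have S_meas2 [measurable]: "(\<lambda>u. \<integral>\<^sup>+ u'. slab_overlap g t h u u' \<partial>\<pi>) \<in> borel_measurable borel"
    unfolding slab_overlap_def indicator_def mem_Collect_eq by measurable
  let ?chi = "\<lambda>u u'. \<integral>\<^sup>+ x. \<integral>\<^sup>+ y. noise_likelihood p n (\<lambda>i. F u (x i)) y * noise_likelihood p n (\<lambda>i. F u' (x i)) y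
       / noise_likelihood p n (\<lambda>_. 0) y \<partial>PiM {1..n} (\<lambda>_. lborel) \<partial>PiM {1..n} (\<lambda>_. density lborel g)"
  have chi: "?chi u u' \<le> 1 + ennreal (D * exp (D * m)) * slab_overlap g t h u u'"
    if u: "slab_overlap g t h u u \<le> ennreal m" for u u'
  proof -
    have "slab_overlap g t h u u' \<le> slab_overlap g t h u u"
      unfolding slab_overlap_def by (intro nn_integral_mono) (auto split: split_indicator)
    then have le_m: "slab_overlap g t h u u' \<le> ennreal m" using u by (rule order_trans)
    then obtain s where s: "slab_overlap g t h u u' = ennreal s" "0 \<le> s"
      by (cases "slab_overlap g t h u u'") (auto simp: top_unique)
    have sm: "s \<le> m" using le_m \<open>m \<ge> 0\<close> unfolding s(1) by simp
    have "(\<integral>\<^sup>+ x. ennreal (g x) * ennreal \<bar>F u x * F u' x\<bar> \<partial>lborel)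
      \<le> (\<integral>\<^sup>+ x. ennreal (A\<^sup>2) * (ennreal (g x) * (indicator {x. \<bar>(x - t) \<bullet> sgn u\<bar> \<le> h} x
          * indicator {x. \<bar>(x - t) \<bullet> sgn u'\<bar> \<le> h} x)) \<partial>lborel)"
    proof (rule nn_integral_mono)
      fix x
      have "\<bar>F u x * F u' x\<bar> \<le> (A * indicator {x. \<bar>(x - t) \<bullet> sgn u\<bar> \<le> h} x) * (A * indicator {x. \<bar>(x - t) \<bullet> sgn u'\<bar> \<le> h} x)"
        unfolding abs_mult using A by (intro mult_mono F_bound) auto
      then have "ennreal \<bar>F u x * F u' x\<bar> \<le> ennreal ((A * indicator {x. \<bar>(x - t) \<bullet> sgn u\<bar> \<le> h} x) * (A * indicator {x. \<bar>(x - t) \<bullet> sgn u'\<bar> \<le> h} x))"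
        by (rule ennreal_leI)
      also have "\<dots> = ennreal (A\<^sup>2) * (indicator {x. \<bar>(x - t) \<bullet> sgn u\<bar> \<le> h} x * indicator {x. \<bar>(x - t) \<bullet> sgn u'\<bar> \<le> h} x)"
        by (auto simp: indicator_def power2_eq_square)
      finally show "ennreal (g x) * ennreal \<bar>F u x * F u' x\<bar> \<le> ennreal (A\<^sup>2) * (ennreal (g x) *
         (indicator {x. \<bar>(x - t) \<bullet> sgn u\<bar> \<le> h} x * indicator {x. \<bar>(x - t) \<bullet> sgn u'\<bar> \<le> h} x))"
        using mult_left_mono[of _ _ "ennreal (g x)"] by (simp add: mult.left_commute)
    qed
    also have "\<dots> = ennreal (A\<^sup>2) * ennreal s"
      unfolding s(1)[symmetric] slab_overlap_def indicator_def mem_Collect_eq by (rule nn_integral_cmult) measurable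
    finally have *: "(\<integral>\<^sup>+ x. ennreal (g x) * ennreal \<bar>F u x * F u' x\<bar> \<partial>lborel) \<le> ennreal (A\<^sup>2) * ennreal s" .
    have "?chi u u' \<le> (1 + ennreal Q * (\<integral>\<^sup>+ x. ennreal (g x) * ennreal \<bar>F u x * F u' x\<bar> \<partial>lborel)) ^ n"
      by (rule chi_square_regression[OF g p \<open>Q \<ge> 0\<close> shift Fu Fu F_q F_q])
    also have "\<dots> \<le> (1 + ennreal Q * (ennreal (A\<^sup>2) * ennreal s)) ^ n"
      by (intro power_mono add_left_mono mult_left_mono *) auto
    also have "\<dots> = ennreal ((1 + Q * A\<^sup>2 * s) ^ n)"
      using \<open>Q \<ge> 0\<close> s(2) by (simp add: ennreal_mult[symmetric] ennreal_power mult.assoc flip: ennreal_1 ennreal_plus)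
    also have "\<dots> \<le> ennreal (1 + real n * (Q * A\<^sup>2 * s) * exp (D * m))"
    proof (intro ennreal_leI one_plus_power_le)
      have "D * s \<le> D * m" using sm D0 by (rule mult_left_mono)
      then show "real n * (Q * A\<^sup>2 * s) \<le> D * m" by (simp add: D_def mult_ac)
    qed (use \<open>Q \<ge> 0\<close> s(2) in simp)
    also have "real n * (Q * A\<^sup>2 * s) * exp (D * m) = D * exp (D * m) * s" by (simp add: D_def)
    also have "ennreal (1 + D * exp (D * m) * s) = 1 + ennreal (D * exp (D * m)) * slab_overlap g t h u u'"
      unfolding s(1) using D0 s(2) by (simp add: ennreal_plus ennreal_mult)
    finally show ?thesis .
  qed
  have "(\<integral>\<^sup>+ u. \<integral>\<^sup>+ u'. ?chi u u' \<partial>\<pi> \<partial>\<pi>) \<le> (\<integral>\<^sup>+ u. 1 + ennreal (D * exp (D * m)) * (\<integral>\<^sup>+ u'. slab_overlap g t h u u' \<partial>\<pi>) \<partial>\<pi>)"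
  proof (rule nn_integral_mono_AE, rule AE_mp[OF \<pi>(3)], intro AE_I2 impI)
    fix u assume u: "u \<noteq> 0 \<and> slab_overlap g t h u u \<le> ennreal m"
    have "(\<integral>\<^sup>+ u'. ?chi u u' \<partial>\<pi>) \<le> (\<integral>\<^sup>+ u'. 1 + ennreal (D * exp (D * m)) * slab_overlap g t h u u' \<partial>\<pi>)"
      using u by (intro nn_integral_mono chi) auto
    also have "\<dots> = 1 + ennreal (D * exp (D * m)) * (\<integral>\<^sup>+ u'. slab_overlap g t h u u' \<partial>\<pi>)"
      by (subst nn_integral_add, measurable) (simp add: nn_integral_cmult \<pi>.emeasure_space_1)
    finally show "(\<integral>\<^sup>+ u'. ?chi u u' \<partial>\<pi>) \<le> 1 + ennreal (D * exp (D * m)) * (\<integral>\<^sup>+ u'. slab_overlap g t h u u' \<partial>\<pi>)" .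
  qed
  also have "\<dots> = 1 + ennreal (D * exp (D * m)) * (\<integral>\<^sup>+ u. \<integral>\<^sup>+ u'. slab_overlap g t h u u' \<partial>\<pi> \<partial>\<pi>)"
    by (subst nn_integral_add, measurable) (simp add: nn_integral_cmult \<pi>.emeasure_space_1)
  also have "\<dots> \<le> 1 + ennreal (D * exp (D * m)) * ennreal e"
    by (intro add_left_mono mult_left_mono \<pi>) auto
  also have "\<dots> \<le> 1 + ennreal 1"
  proof (rule add_left_mono)
    have "ennreal (D * exp (D * m)) * ennreal e = ennreal (D * exp (D * m) * e)"
      using D0 \<open>e \<ge> 0\<close> by (simp add: ennreal_mult)
    also have "\<dots> \<le> ennreal 1" using info by (intro ennreal_leI) (simp add: D_def A_def)
    finally show "ennreal (D * exp (D * m)) * ennreal e \<le> ennreal 1" .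
  qed
  finally have chi2: "(\<integral>\<^sup>+ u. \<integral>\<^sup>+ u'. ?chi u u' \<partial>\<pi> \<partial>\<pi>) \<le> 2" by (simp add: one_add_one)
  define s where "s = A * \<phi> 0 / 2"
  have "\<exists>f\<in>single_index_class \<beta> L. ennreal (s / 4) \<le> risk g p n r t T f"
  proof (rule risk_lower_bound_from_mixture[OF g p \<pi>(1) F_meas _ _ _ _ \<open>r \<ge> 1\<close> T chi2])
    show "(\<lambda>_. 0) \<in> single_index_class \<beta> L" using pos by (intro zero_in_single_index_class) auto
    show "AE u in \<pi>. F u \<in> single_index_class \<beta> L" using \<pi>(3) by eventually_elim (use F_class in auto)
    show "F u t = 2 * s" for u by (simp add: F_def s_def)
    show "s > 0" using A \<phi>(3) by (simp add: s_def)
  qed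
  then show ?thesis by (simp add: s_def A_def)
qed

section \<open>The choice of the bandwidth\<close>

text \<open>The bandwidth is chosen such that \<open>N L\<^sup>2 h\<^sup>2\<^sup>\<beta>\<^sup>+\<^sup>1 = a x\<close>. For \<open>N = n\<close> and \<open>x = ln n\<close> the first
  identity says that the information in one slab is of order \<open>ln n\<close>, the second that \<open>L h\<^sup>\<beta>\<close> is a
  multiple of the rate.\<close>
lemma bandwidth_identities:
  fixes a L \<beta> x N :: real
  assumes pos: "a > 0" "L > 0" "\<beta> > 0" "x > 0" "N > 0"
  defines "\<gamma> \<equiv> 1 / (2 * \<beta> + 1)"
  defines "h \<equiv> (a / L\<^sup>2 * (x / N)) powr \<gamma>"
  shows "N * (L * h powr \<beta>)\<^sup>2 * h = a * x"
    and "L * h powr \<beta> = a powr (\<beta> * \<gamma>) * (L powr \<gamma> * (inverse N * x) powr (\<beta> * \<gamma>))"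
proof -
  have \<gamma>: "\<gamma> * (2 * \<beta> + 1) = 1" using pos by (simp add: \<gamma>_def)
  have base: "a / L\<^sup>2 * (x / N) > 0" using pos by simp
  have h: "h > 0" unfolding h_def using pos by simp
  have "h powr \<beta> * h powr \<beta> * h = h powr (\<beta> + \<beta> + 1)"
    using h by (simp only: powr_add powr_one)
  also have "\<beta> + \<beta> + 1 = 2 * \<beta> + 1" by simp
  also have "h powr (2 * \<beta> + 1) = a / L\<^sup>2 * (x / N)"
    unfolding h_def powr_powr \<gamma> using base by (simp only: powr_one less_imp_le)
  finally have "h powr \<beta> * h powr \<beta> * h = a / L\<^sup>2 * (x / N)" .
  then have "N * L\<^sup>2 * (h powr \<beta> * h powr \<beta> * h) = N * L\<^sup>2 * (a / L\<^sup>2 * (x / N))" by (rule arg_cong)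
  also have "\<dots> = a * x" using pos by simp
  finally show "N * (L * h powr \<beta>)\<^sup>2 * h = a * x"
    by (simp only: power2_eq_square mult_ac)
  have "h powr \<beta> = (a / L\<^sup>2 * (x / N)) powr (\<beta> * \<gamma>)"
    unfolding h_def powr_powr by (simp only: mult.commute)
  also have "\<dots> = (a / L\<^sup>2) powr (\<beta> * \<gamma>) * (x / N) powr (\<beta> * \<gamma>)"
    using pos by (intro powr_mult)
  also have "(a / L\<^sup>2) powr (\<beta> * \<gamma>) = a powr (\<beta> * \<gamma>) / (L powr 2) powr (\<beta> * \<gamma>)"
    using pos by (simp add: powr_divide powr_numeral)
  finally have hb: "h powr \<beta> = a powr (\<beta> * \<gamma>) / (L powr 2) powr (\<beta> * \<gamma>) * (x / N) powr (\<beta> * \<gamma>)" .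
  have "\<gamma> + 2 * (\<beta> * \<gamma>) = 1" using \<gamma> by (simp add: algebra_simps)
  then have "L powr \<gamma> * (L powr 2) powr (\<beta> * \<gamma>) = L"
    using pos powr_one[of L] unfolding powr_powr powr_add[symmetric] by simp
  then have "L / (L powr 2) powr (\<beta> * \<gamma>) = L powr \<gamma>"
    using pos by (simp add: field_simps)
  then show "L * h powr \<beta> = a powr (\<beta> * \<gamma>) * (L powr \<gamma> * (inverse N * x) powr (\<beta> * \<gamma>))"
    unfolding hb by (simp add: divide_inverse mult_ac)
qed

text \<open>Since \<open>h\<close> is of order \<open>(ln n / n)\<^sup>\<gamma>\<close> with \<open>\<gamma> = 1 / (2 \<beta> + 1)\<close>, the gain \<open>h\<^sup>1\<^sup>/\<^sup>2\<close> beats the factor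
  \<open>n\<^sup>\<gamma>\<^sup>/\<^sup>4\<close>: their product is of order \<open>n\<^sup>-\<^sup>\<gamma>\<^sup>/\<^sup>4\<close> up to logarithms.\<close>
lemma bandwidth_asymptotics:
  fixes a L \<beta> c b :: real
  assumes "a > 0" "L > 0" "\<beta> > 0" "b > 0"
  defines "h \<equiv> (\<lambda>n. (a / L\<^sup>2 * (ln (real n) / real n)) powr (1 / (2 * \<beta> + 1)))"
  shows "\<forall>\<^sub>F n in sequentially. 0 < h n \<and> h n \<le> 1 \<and> L * h n powr \<beta> \<le> b \<and>
    c * ln (real n) * h n powr (1 / 2) * real n powr (1 / (4 * (2 * \<beta> + 1))) \<le> 1"
proof -
  define \<gamma> where "\<gamma> = 1 / (2 * \<beta> + 1)"
  have \<gamma>: "\<gamma> > 0" using assms by (simp add: \<gamma>_def)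
  define K where "K = (a / L\<^sup>2) powr (\<gamma> / 2)"
  have "(\<lambda>n. ln (real n) / real n) \<longlonglongrightarrow> 0" by (rule lim_ln_over_n)
  then have "(\<lambda>n. a / L\<^sup>2 * (ln (real n) / real n)) \<longlonglongrightarrow> 0" by (rule tendsto_mult_right_zero)
  moreover have "\<forall>\<^sub>F n in sequentially. 0 \<le> a / L\<^sup>2 * (ln (real n) / real n)"
    using eventually_ge_at_top[of 1] by eventually_elim (use assms in simp)
  ultimately have h0: "h \<longlonglongrightarrow> 0"
    unfolding h_def \<gamma>_def[symmetric] using \<gamma> by (intro tendsto_zero_powrI[OF _ tendsto_const]) auto
  then have "(\<lambda>n. h n powr \<beta>) \<longlonglongrightarrow> 0" using \<open>\<beta> > 0\<close>
    by (intro tendsto_zero_powrI[OF _ tendsto_const]) (auto simp: h_def)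
  then have Lh0: "(\<lambda>n. L * h n powr \<beta>) \<longlonglongrightarrow> 0" by (rule tendsto_mult_right_zero)
  have "(\<lambda>n. ln (real n) / real n powr (\<gamma> / 8)) \<longlonglongrightarrow> 0" using \<gamma> by (intro lim_ln_over_power) auto
  moreover have "(\<lambda>n. (ln (real n) / real n powr (1 / 4)) powr (\<gamma> / 2)) \<longlonglongrightarrow> 0"
  proof (rule tendsto_zero_powrI[OF _ tendsto_const])
    show "(\<lambda>n. ln (real n) / real n powr (1 / 4)) \<longlonglongrightarrow> 0" by (intro lim_ln_over_power) auto
    show "\<forall>\<^sub>F n in sequentially. 0 \<le> ln (real n) / real n powr (1 / 4)"
      using eventually_ge_at_top[of 1] by eventually_elim simp
    show "0 < \<gamma> / 2" using \<gamma> by simp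
  qed
  ultimately have "(\<lambda>n. c * K * ((ln (real n) / real n powr (\<gamma> / 8)) * (ln (real n) / real n powr (1 / 4)) powr (\<gamma> / 2))) \<longlonglongrightarrow> 0"
    by (intro tendsto_mult_right_zero tendsto_mult_zero)
  then have e: "\<forall>\<^sub>F n in sequentially. c * K * ((ln (real n) / real n powr (\<gamma> / 8)) * (ln (real n) / real n powr (1 / 4)) powr (\<gamma> / 2)) < 1"
    by (rule order_tendstoD) simp
  have e1: "\<forall>\<^sub>F n in sequentially. h n < 1" using h0 by (rule order_tendstoD) simp
  have e2: "\<forall>\<^sub>F n in sequentially. L * h n powr \<beta> < b" using Lh0 \<open>b > 0\<close> by (rule order_tendstoD)
  show ?thesis
    using e e1 e2 eventually_ge_at_top[of 2]
  proof eventually_elim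
    case (elim n)
    have n: "real n > 1" using elim by simp
    have ln: "ln (real n) > 0" using n by simp
    have "h n > 0" unfolding h_def using n ln assms by simp
    have "h n powr (1 / 2) = (a / L\<^sup>2 * (ln (real n) / real n)) powr (\<gamma> / 2)"
      unfolding h_def \<gamma>_def[symmetric] by (simp add: powr_powr)
    also have "\<dots> = K * (ln (real n) / real n) powr (\<gamma> / 2)"
      unfolding K_def using n ln assms by (intro powr_mult)
    finally have hn: "h n powr (1 / 2) = K * (ln (real n) / real n) powr (\<gamma> / 2)" .
    have "(ln (real n) / real n) powr (\<gamma> / 2) * real n powr (\<gamma> / 4)
      = ln (real n) powr (\<gamma> / 2) * real n powr (- (\<gamma> / 2)) * real n powr (\<gamma> / 4)"
      using n ln by (simp add: powr_divide powr_minus_divide)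
    also have "\<dots> = ln (real n) powr (\<gamma> / 2) * real n powr (- (\<gamma> / 4))"
      by (simp add: mult.assoc flip: powr_add)
    also have "real n powr (- (\<gamma> / 4)) = real n powr (- (\<gamma> / 8)) * real n powr (- (\<gamma> / 8))"
      by (simp flip: powr_add)
    also have "ln (real n) powr (\<gamma> / 2) * (real n powr (- (\<gamma> / 8)) * real n powr (- (\<gamma> / 8))) =
        (ln (real n) / real n powr (1 / 4)) powr (\<gamma> / 2) / real n powr (\<gamma> / 8)"
      using n ln by (simp add: powr_divide powr_minus_divide powr_powr)
    finally have *: "(ln (real n) / real n) powr (\<gamma> / 2) * real n powr (\<gamma> / 4) =
      (ln (real n) / real n powr (1 / 4)) powr (\<gamma> / 2) / real n powr (\<gamma> / 8)" .
    have expo: "1 / (4 * (2 * \<beta> + 1)) = \<gamma> / 4" by (simp add: \<gamma>_def)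
    have "c * ln (real n) * h n powr (1 / 2) * real n powr (1 / (4 * (2 * \<beta> + 1)))
      = c * ln (real n) * K * ((ln (real n) / real n) powr (\<gamma> / 2) * real n powr (\<gamma> / 4))"
      unfolding hn expo by (simp only: mult_ac)
    also have "\<dots> = c * K * ((ln (real n) / real n powr (\<gamma> / 8)) * (ln (real n) / real n powr (1 / 4)) powr (\<gamma> / 2))"
      unfolding * by simp
    finally show ?case using elim \<open>h n > 0\<close> by simp
  qed
qed

theorem theorem4:
  fixes g :: "real^'d \<Rightarrow> real" and p :: "real \<Rightarrow> real"
    and \<Upsilon> \<Omega> \<omega> r \<beta> :: real and t :: "real^'d"
  assumes "CARD('d) \<ge> 2"
    and "\<Upsilon> > 0" and "\<Omega> \<in> {0<..1}" and "\<omega> > 0"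
    and "prob_density g"
    and "noise_density p \<Upsilon> \<Omega> \<omega>"
    and "shift_condition p"
    and "design_condition g"
    and "\<forall>i. t $ i \<in> {-1/2..1/2}"
    and "r \<ge> 1" and "\<beta> > 0"
  shows "\<exists>\<kappa>>0. \<forall>L>0. \<forall>\<^sub>F n in sequentially.
    (INF T\<in>estimators n. SUP F\<in>single_index_class \<beta> L. risk g p n r t T F)
      \<ge> ennreal (\<kappa> * rate n \<beta> L)"
proof -
  have p: "prob_density p" using \<open>noise_density p \<Upsilon> \<Omega> \<omega>\<close> by (simp add: noise_density_def)
  obtain q Q where qQ: "q > 0" "Q > 0" and shift: "\<And>v w. \<bar>v\<bar> \<le> q \<Longrightarrow> \<bar>w\<bar> \<le> q \<Longrightarrow>
      (\<integral>\<^sup>+ y. ennreal (p (y + v)) * ennreal (p (y + w)) / ennreal (p y) \<partial>lborel) \<le> ennreal (1 + Q * \<bar>v * w\<bar>)"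
    using \<open>shift_condition p\<close> unfolding shift_condition_def by (auto simp: abs_le_iff minus_le_iff)
  obtain G where G: "\<And>x. g x \<le> G"
  proof -
    obtain G \<rho> where G0: "G > 0" and le: "\<And>x. g x \<le> inverse (1 + norm x powr \<rho>) * G"
      using \<open>design_condition g\<close> unfolding design_condition_def by blast
    have "inverse (1 + norm x powr \<rho>) * G \<le> 1 * G" for x :: "real^'d"
      using G0 by (intro mult_right_mono) (auto simp: inverse_le_1_iff)
    with le show ?thesis by (intro that[of G]) (use order_trans in fastforce)
  qed
  have "DIM(real^'d) \<ge> 2" using \<open>CARD('d) \<ge> 2\<close> by simp
  from exists_direction_prior[OF this \<open>prob_density g\<close> G, of t]
  obtain C\<^sub>1 C\<^sub>2 where C: "C\<^sub>1 > 0" "C\<^sub>2 > 0" and prior: "\<And>h. h > 0 \<Longrightarrow> \<exists>\<pi>. prob_space \<pi> \<and> sets \<pi> = sets borel \<and>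
       (AE u in \<pi>. u \<noteq> 0 \<and> slab_overlap g t h u u \<le> ennreal (C\<^sub>1 * h)) \<and>
       (\<integral>\<^sup>+ u. \<integral>\<^sup>+ u'. slab_overlap g t h u u' \<partial>\<pi> \<partial>\<pi>) \<le> ennreal (C\<^sub>2 * h powr (3 / 2))"
    by blast
  obtain \<phi> :: "real \<Rightarrow> real" where \<phi>: "\<phi> \<in> holder_class \<beta> 1" "continuous_on UNIV \<phi>" "\<phi> 0 > 0"
    "\<And>x. \<bar>\<phi> x\<bar> \<le> indicator {-1..1} x"
    using exists_holder_bump[OF \<open>\<beta> > 0\<close>] by blast
  define \<gamma> where "\<gamma> = 1 / (2 * \<beta> + 1)"
  have \<gamma>: "\<gamma> > 0" "(2 * \<beta> + 1) * \<gamma> = 1" using \<open>\<beta> > 0\<close> by (auto simp: \<gamma>_def)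
  \<comment> \<open>With this \<open>a\<close> the exponential of the largest possible exponent is \<open>n\<^sup>\<gamma>\<^sup>/\<^sup>4\<close>.\<close>
  define a where "a = \<gamma> / (4 * Q * C\<^sub>1)"
  have a: "a > 0" "Q * a * C\<^sub>1 = \<gamma> / 4" using \<gamma> qQ C by (auto simp: a_def)
  define \<kappa> where "\<kappa> = a powr (\<beta> * \<gamma>) * \<phi> 0 / 8"
  have \<kappa>: "\<kappa> > 0" using a \<phi>(3) by (simp add: \<kappa>_def)
  have "\<forall>\<^sub>F n in sequentially. ennreal (\<kappa> * rate n \<beta> L) \<le>
    (INF T\<in>estimators n. SUP F\<in>single_index_class \<beta> L. risk g p n r t T F)" if L: "L > 0" for L
  proof -
    define h where "h n = (a / L\<^sup>2 * (ln (real n) / real n)) powr \<gamma>" for n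
    show ?thesis
      using bandwidth_asymptotics[OF a(1) L \<open>\<beta> > 0\<close> qQ(1), of "Q * a * C\<^sub>2", folded \<gamma>_def, folded h_def]
        eventually_ge_at_top[of 2]
    proof eventually_elim
      case (elim n)
      have n: "real n > 1" using elim by simp
      have ln: "ln (real n) > 0" using n by simp
      from elim have h: "0 < h n" "h n \<le> 1" "L * h n powr \<beta> \<le> q" by auto
      note identities = bandwidth_identities[OF a(1) L \<open>\<beta> > 0\<close> ln order.strict_trans[OF zero_less_one n],
          folded \<gamma>_def, folded h_def]
      have info_h: "real n * Q * (L * h n powr \<beta>)\<^sup>2 * h n = Q * a * ln (real n)"
        using arg_cong[OF identities(1), of "(*) Q"] by (simp only: mult_ac)
      have "real n * Q * (L * h n powr \<beta>)\<^sup>2 * (C\<^sub>1 * h n)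
          = (real n * Q * (L * h n powr \<beta>)\<^sup>2 * h n) * C\<^sub>1" by (simp only: mult_ac)
      also have "\<dots> = (Q * a * C\<^sub>1) * ln (real n)" unfolding info_h by (simp only: mult_ac)
      finally have info_exp: "real n * Q * (L * h n powr \<beta>)\<^sup>2 * (C\<^sub>1 * h n) = \<gamma> / 4 * ln (real n)"
        unfolding a(2) .
      have h32: "h n powr (3 / 2) = h n * h n powr (1 / 2)"
        using h powr_add[of "h n" 1 "1 / 2"] by simp
      have "real n * Q * (L * h n powr \<beta>)\<^sup>2 * exp (real n * Q * (L * h n powr \<beta>)\<^sup>2 * (C\<^sub>1 * h n)) * (C\<^sub>2 * h n powr (3 / 2))
        = (real n * Q * (L * h n powr \<beta>)\<^sup>2 * h n) * C\<^sub>2 * h n powr (1 / 2) * exp (\<gamma> / 4 * ln (real n))"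
        unfolding info_exp h32 by (simp only: mult_ac)
      also have "\<dots> = Q * a * C\<^sub>2 * ln (real n) * h n powr (1 / 2) * real n powr (\<gamma> / 4)"
        unfolding info_h using n by (simp add: powr_def mult_ac)
      also have "\<dots> \<le> 1" using elim by (simp add: \<gamma>_def)
      finally have info: "real n * Q * (L * h n powr \<beta>)\<^sup>2 * exp (real n * Q * (L * h n powr \<beta>)\<^sup>2 * (C\<^sub>1 * h n)) *
         (C\<^sub>2 * h n powr (3 / 2)) \<le> 1" .
      from prior[OF h(1)] obtain \<pi> where \<pi>: "prob_space \<pi>" "sets \<pi> = sets borel"
        "AE u in \<pi>. u \<noteq> 0 \<and> slab_overlap g t (h n) u u \<le> ennreal (C\<^sub>1 * h n)"
        "(\<integral>\<^sup>+ u. \<integral>\<^sup>+ u'. slab_overlap g t (h n) u u' \<partial>\<pi> \<partial>\<pi>) \<le> ennreal (C\<^sub>2 * h n powr (3 / 2))"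
        by blast
      have "rate n \<beta> L = L powr \<gamma> * (inverse (real n) * ln (real n)) powr (\<beta> * \<gamma>)"
        by (simp add: rate_def \<gamma>_def)
      then have rate: "L * h n powr \<beta> * \<phi> 0 / 8 = \<kappa> * rate n \<beta> L"
        using identities(2) by (simp add: \<kappa>_def)
      show ?case
      proof (rule INF_greatest)
        fix T :: "(nat \<Rightarrow> (real^'d) \<times> real) \<Rightarrow> real^'d \<Rightarrow> real" assume T: "T \<in> estimators n"
        obtain F where F: "F \<in> single_index_class \<beta> L" "ennreal (\<kappa> * rate n \<beta> L) \<le> risk g p n r t T F"
          using single_index_risk_lower_bound[OF \<open>prob_density g\<close> p less_imp_le[OF qQ(2)] shift \<phi> \<open>\<beta> > 0\<close> L h \<pi> _ _ info \<open>r \<ge> 1\<close> T]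
            C h unfolding rate by auto
        have "risk g p n r t T F \<le> (SUP F\<in>single_index_class \<beta> L. risk g p n r t T F)"
          using F(1) by (rule SUP_upper)
        with F(2) show "ennreal (\<kappa> * rate n \<beta> L) \<le> (SUP F\<in>single_index_class \<beta> L. risk g p n r t T F)"
          by (rule order_trans)
      qed
    qed
  qed
  then show ?thesis using \<kappa> by blast
qed

end
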